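(* Let $(A,\lambda_A)$ be a $\lambda$-ring, let $(M,\lambda_M)$ be an $(A,\lambda_A)$-module, and let $f\colon(A\ltimes M,\lambda_{A\ltimes M})\to(A,\lambda_A)$ be the canonical projection. The map $$\operatorname{Der}((A,\lambda_A),(M,\lambda_M))\to\operatorname{Hom}_{\mathscr{A}_\lambda/(A,\lambda_A)}(\mathrm{id}_{(A,\lambda_A)},f)$$ that to $D$ assigns $(\mathrm{id}_A,D)$ is a bijection.
   Context: Rings are commutative and unital; $\mathbb{N}$ is the set of positive integers. $\mathbb{W}(A)$ is the set $A^{\mathbb{N}}$ with the unique ring structure, functorial in $A$, for which all ghost maps $w_n(a)=\sum_{e\mid n}ea_e^{n/e}$ are natural ring homomorphisms; it is also defined for non-unital rings. $F_n\colon\mathbb{W}(A)\to\mathbb{W}(A)$ is the natural ring homomorphism with $w_e\circ F_n=w_{ne}$; $\Delta_A\colon\mathbb{W}(A)\to\mathbb{W}(\mathbb{W}(A))$ is the unique natural ring homomorphism with $w_n\circ\Delta_A=F_n$; $\epsilon_A=w_1$. A $\lambda$-ring is a pair $(A,\lambda_A)$ with $\lambda_A\colon A\to\mathbb{W}(A)$ a ring homomorphism such that $\epsilon_A\lambda_A=\mathrm{id}$ and $\mathbb{W}(\lambda_A)\lambda_A=\Delta_A\lambda_A$; a morphism $f\colon(A,\lambda_A)\to(B,\lambda_B)$ is a ring homomorphism with $\lambda_Bf=\mathbb{W}(f)\lambda_A$. $\mathscr{A}_\lambda$ is the category of $\lambda$-rings, and $\mathscr{A}_\lambda/(A,\lambda_A)$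 the category of objects over $(A,\lambda_A)$. $\lambda_{A,n}$ is the $n$th Witt component of $\lambda_A$ and $\psi_{A,n}=w_n\circ\lambda_A$. An $(A,\lambda_A)$-module is a pair $(M,\lambda_M)$ of an $A$-module $M$ and additive maps $\lambda_{M,n}\colon M\to M$, $n\in\mathbb{N}$, with $\lambda_{M,n}(ax)=\psi_{A,n}(a)\lambda_{M,n}(x)$, $\lambda_{M,1}=\mathrm{id}$, $\lambda_{M,m}\lambda_{M,n}=\lambda_{M,mn}$; write $\lambda_M=(\lambda_{M,n})_n\colon M\to\mathbb{W}(M)$, where $\mathbb{W}(M)=M^{\mathbb{N}}$ with componentwise addition (the Witt vectors of $M$ viewed as non-unital ring with zero multiplication). $A\ltimes M$ is the ring $A\oplus M$ with $(a,x)(a',x')=(aa',ax'+a'x)$. Its $\lambda$-ring structure $\lambda_{A\ltimes M}\colon A\ltimes M\to\mathbb{W}(A\ltimes M)$ is $(a,x)\mapsto\mathrm{in}_{1*}(\lambda_A(a))+\mathrm{in}_{2*}(\lambda_M(x))$, where $\mathrm{in}_{1*}\colon\mathbb{W}(A)\to\mathbb{W}(A\ltimes M)$ and $\mathrm{in}_{2*}\colon\mathbb{W}(M)\to\mathbb{W}(A\ltimes M)$ are induced by the inclusions $\mathrm{in}_1(a)=(a,0)$ and $\mathrm{in}_2(x)=(0,x)$. $\operatorname{Der}((A,\lambda_A),(M,\lambda_M))$ is the set of maps $D\colon A\to M$ with $D(a+b)=D(a)+D(b)$, $D(ab)=bD(a)+aD(b)$, and $\lambda_{M,n}(D(a))=\sum_{e\mid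 n}\lambda_{A,e}(a)^{(n/e)-1}D(\lambda_{A,e}(a))$ for all $a,b\in A$, $n\in\mathbb{N}$. *)

theory Defs
  imports "HOL-Algebra.Module" "HOL-Library.Poly_Mapping"
begin

section \<open>Integer polynomials\<close>

text \<open>
  Integer polynomials in variables indexed by \<open>'v\<close>: finitely supported functions from monomials
  (finitely supported exponent functions) to coefficients. The ring operations are those of
  \<^theory>\<open>HOL-Library.Poly_Mapping\<close>.
\<close>

type_synonym 'v ipoly = "('v \<Rightarrow>\<^sub>0 nat) \<Rightarrow>\<^sub>0 int"

definition ipoly_var :: "'v \<Rightarrow> 'v ipoly"
  where "ipoly_var v = Poly_Mapping.single (Poly_Mapping.single v 1) 1"

definition ipoly_ring :: "'v ipoly ring"
  where "ipoly_ring = \<lparr>carrier = UNIV, monoid.mult = (*), monoid.one = 1, ring.zero = 0, ring.add = (+)\<rparr>"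

definition ipoly_eval :: "('a, 'm) ring_scheme \<Rightarrow> ('v \<Rightarrow> 'a) \<Rightarrow> 'v ipoly \<Rightarrow> 'a"
  where "ipoly_eval R a p =
    (\<Oplus>\<^bsub>R\<^esub>m\<in>Poly_Mapping.keys p.
       [Poly_Mapping.lookup p m] \<cdot>\<^bsub>R\<^esub>
         (\<Otimes>\<^bsub>R\<^esub>v\<in>Poly_Mapping.keys m. a v [^]\<^bsub>R\<^esub> Poly_Mapping.lookup m v))"


section \<open>Big Witt vectors\<close>

text \<open>
  Witt vectors are indexed by the positive integers. They are represented by functions on \<open>nat\<close>
  that are extensional on \<open>{0<..}\<close> (that is, \<open>undefined\<close> at \<open>0\<close>), so that equality of functions
  is equality of Witt vectors.
\<close>

definition witt_carrier :: "('a, 'm) ring_scheme \<Rightarrow> (nat \<Rightarrow> 'a) set"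
  where "witt_carrier R = {0<..} \<rightarrow>\<^sub>E carrier R"

definition witt_ghost :: "('a, 'm) ring_scheme \<Rightarrow> nat \<Rightarrow> (nat \<Rightarrow> 'a) \<Rightarrow> 'a"
  where "witt_ghost R n a = (\<Oplus>\<^bsub>R\<^esub>e\<in>{e. e dvd n}. [e] \<cdot>\<^bsub>R\<^esub> (a e [^]\<^bsub>R\<^esub> (n div e)))"

definition witt_map :: "('a \<Rightarrow> 'b) \<Rightarrow> (nat \<Rightarrow> 'a) \<Rightarrow> nat \<Rightarrow> 'b"
  where "witt_map f a = (\<lambda>n\<in>{0<..}. f (a n))"

text \<open>
  A natural operation on Witt vectors is determined by its value on the generic arguments, whose
  components are the variables of a polynomial ring over the integers. As this ring is torsion
  free, the requirements on ghost components determine this value uniquely; that it exists is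
  Dwork's lemma. In the next two definitions \<open>Inl n\<close> and \<open>Inr n\<close> index the \<open>n\<close>th components of the
  two generic summands or factors.
\<close>

definition witt_add_poly :: "nat \<Rightarrow> (nat + nat) ipoly"
  where "witt_add_poly =
    (THE s. s \<in> witt_carrier ipoly_ring \<and>
       (\<forall>n>0. witt_ghost ipoly_ring n s =
          witt_ghost ipoly_ring n (\<lambda>i. ipoly_var (Inl i))
            \<oplus>\<^bsub>ipoly_ring\<^esub> witt_ghost ipoly_ring n (\<lambda>i. ipoly_var (Inr i))))"

definition witt_mult_poly :: "nat \<Rightarrow> (nat + nat) ipoly"
  where "witt_mult_poly =
    (THE p. p \<in> witt_carrier ipoly_ring \<and>
       (\<forall>n>0. witt_ghost ipoly_ring n p =
          witt_ghost ipoly_ring n (\<lambda>i. ipoly_var (Inl i))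
            \<otimes>\<^bsub>ipoly_ring\<^esub> witt_ghost ipoly_ring n (\<lambda>i. ipoly_var (Inr i))))"

text \<open>
  The zero and the unit are the Witt vectors \<open>(0, 0, \<dots>)\<close> and \<open>(1, 0, 0, \<dots>)\<close>, all of whose ghost
  components are \<open>0\<close> and \<open>1\<close>, respectively.
\<close>

definition witt_ring :: "('a, 'm) ring_scheme \<Rightarrow> (nat \<Rightarrow> 'a) ring"
  where "witt_ring R =
    \<lparr>carrier = witt_carrier R,
     monoid.mult = (\<lambda>a b. \<lambda>n\<in>{0<..}. ipoly_eval R (case_sum a b) (witt_mult_poly n)),
     monoid.one = (\<lambda>n\<in>{0<..}. if n = 1 then \<one>\<^bsub>R\<^esub> else \<zero>\<^bsub>R\<^esub>),
     ring.zero = (\<lambda>n\<in>{0<..}. \<zero>\<^bsub>R\<^esub>),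
     ring.add = (\<lambda>a b. \<lambda>n\<in>{0<..}. ipoly_eval R (case_sum a b) (witt_add_poly n))\<rparr>"

text \<open>The Frobenius \<open>F\<^sub>n\<close>, with \<open>w\<^sub>e \<circ> F\<^sub>n = w\<^sub>n\<^sub>e\<close>.\<close>

definition witt_frobenius_poly :: "nat \<Rightarrow> nat \<Rightarrow> nat ipoly"
  where "witt_frobenius_poly n =
    (THE p. p \<in> witt_carrier ipoly_ring \<and>
       (\<forall>e>0. witt_ghost ipoly_ring e p = witt_ghost ipoly_ring (n * e) ipoly_var))"

definition witt_frobenius :: "('a, 'm) ring_scheme \<Rightarrow> nat \<Rightarrow> (nat \<Rightarrow> 'a) \<Rightarrow> nat \<Rightarrow> 'a"
  where "witt_frobenius R n a = witt_map (ipoly_eval R a) (witt_frobenius_poly n)"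

text \<open>
  The comultiplication \<open>\<Delta>\<close> from \<open>W(R)\<close> to \<open>W(W(R))\<close>, with \<open>w\<^sub>n \<circ> \<Delta> = F\<^sub>n\<close>. Its value on the
  generic Witt vector is a Witt vector over the ring of Witt vectors of the polynomial ring.
\<close>

definition witt_diag_poly :: "nat \<Rightarrow> nat \<Rightarrow> nat ipoly"
  where "witt_diag_poly =
    (THE d. d \<in> witt_carrier (witt_ring ipoly_ring) \<and>
       (\<forall>n>0. witt_ghost (witt_ring ipoly_ring) n d =
          witt_frobenius ipoly_ring n (restrict ipoly_var {0<..})))"

definition witt_diag :: "('a, 'm) ring_scheme \<Rightarrow> (nat \<Rightarrow> 'a) \<Rightarrow> nat \<Rightarrow> nat \<Rightarrow> 'a"
  where "witt_diag R a = witt_map (witt_map (ipoly_eval R a)) witt_diag_poly"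


section \<open>\<open>\<lambda>\<close>-rings and their modules\<close>

locale lambda_ring = cring A for A (structure) +
  fixes lam :: "'a \<Rightarrow> nat \<Rightarrow> 'a"
  assumes lam_hom: "lam \<in> ring_hom A (witt_ring A)"
    and lam_counit: "a \<in> carrier A \<Longrightarrow> witt_ghost A 1 (lam a) = a"
    and lam_coassoc: "a \<in> carrier A \<Longrightarrow> witt_map lam (lam a) = witt_diag A (lam a)"

text \<open>Homomorphisms are taken extensional, so that equal maps on the carrier are equal.\<close>

definition lambda_hom ::
    "('a, 'm) ring_scheme \<Rightarrow> ('a \<Rightarrow> nat \<Rightarrow> 'a) \<Rightarrow> ('b, 'n) ring_scheme \<Rightarrow> ('b \<Rightarrow> nat \<Rightarrow> 'b)
      \<Rightarrow> ('a \<Rightarrow> 'b) set"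
  where "lambda_hom A lamA B lamB =
    {h \<in> ring_hom A B \<inter> extensional (carrier A).
       \<forall>a\<in>carrier A. lamB (h a) = witt_map h (lamA a)}"

text \<open>
  Morphisms from \<open>p : B \<rightarrow> A\<close> to \<open>q : C \<rightarrow> A\<close> in the category of \<open>\<lambda>\<close>-rings over a
  \<open>\<lambda>\<close>-ring \<open>A\<close>.
\<close>

definition lambda_over_hom ::
    "('x, 'm) ring_scheme \<Rightarrow> ('x \<Rightarrow> nat \<Rightarrow> 'x) \<Rightarrow> ('x \<Rightarrow> 'a)
      \<Rightarrow> ('y, 'n) ring_scheme \<Rightarrow> ('y \<Rightarrow> nat \<Rightarrow> 'y) \<Rightarrow> ('y \<Rightarrow> 'a) \<Rightarrow> ('x \<Rightarrow> 'y) set"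
  where "lambda_over_hom B lamB p C lamC q =
    {h \<in> lambda_hom B lamB C lamC. \<forall>x\<in>carrier B. q (h x) = p x}"

definition adams :: "('a, 'm) ring_scheme \<Rightarrow> ('a \<Rightarrow> nat \<Rightarrow> 'a) \<Rightarrow> nat \<Rightarrow> 'a \<Rightarrow> 'a"
  where "adams A lam n a = witt_ghost A n (lam a)"

locale lambda_module = lambda_ring A lamA + module A M
  for A :: "('a, 'm) ring_scheme" (structure) and lamA and M :: "('a, 'b, 'n) module_scheme" (structure) +
  fixes lamM :: "nat \<Rightarrow> 'b \<Rightarrow> 'b"
  assumes lamM_closed: "n > 0 \<Longrightarrow> x \<in> carrier M \<Longrightarrow> lamM n x \<in> carrier M"
    and lamM_add: "n > 0 \<Longrightarrow> x \<in> carrier M \<Longrightarrow> y \<in> carrier M \<Longrightarrow>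
      lamM n (x \<oplus>\<^bsub>M\<^esub> y) = lamM n x \<oplus>\<^bsub>M\<^esub> lamM n y"
    and lamM_smult: "n > 0 \<Longrightarrow> a \<in> carrier A \<Longrightarrow> x \<in> carrier M \<Longrightarrow>
      lamM n (a \<odot>\<^bsub>M\<^esub> x) = adams A lamA n a \<odot>\<^bsub>M\<^esub> lamM n x"
    and lamM_one: "x \<in> carrier M \<Longrightarrow> lamM 1 x = x"
    and lamM_mult: "m > 0 \<Longrightarrow> n > 0 \<Longrightarrow> x \<in> carrier M \<Longrightarrow>
      lamM m (lamM n x) = lamM (m * n) x"


section \<open>The square-zero extension and derivations\<close>

definition semidirect :: "('a, 'm) ring_scheme \<Rightarrow> ('a, 'b, 'n) module_scheme \<Rightarrow> ('a \<times> 'b) ring"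
  where "semidirect A M =
    \<lparr>carrier = carrier A \<times> carrier M,
     monoid.mult = (\<lambda>(a, x) (a', x'). (a \<otimes>\<^bsub>A\<^esub> a', a \<odot>\<^bsub>M\<^esub> x' \<oplus>\<^bsub>M\<^esub> a' \<odot>\<^bsub>M\<^esub> x)),
     monoid.one = (\<one>\<^bsub>A\<^esub>, \<zero>\<^bsub>M\<^esub>),
     ring.zero = (\<zero>\<^bsub>A\<^esub>, \<zero>\<^bsub>M\<^esub>),
     ring.add = (\<lambda>(a, x) (a', x'). (a \<oplus>\<^bsub>A\<^esub> a', x \<oplus>\<^bsub>M\<^esub> x'))\<rparr>"

text \<open>
  The sum is taken in the ring of Witt vectors of the extension; the maps induced by the two
  inclusions apply them to each Witt component.
\<close>

definition semidirect_lam ::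
    "('a, 'm) ring_scheme \<Rightarrow> ('a \<Rightarrow> nat \<Rightarrow> 'a) \<Rightarrow> ('a, 'b, 'n) module_scheme
      \<Rightarrow> (nat \<Rightarrow> 'b \<Rightarrow> 'b) \<Rightarrow> 'a \<times> 'b \<Rightarrow> nat \<Rightarrow> 'a \<times> 'b"
  where "semidirect_lam A lamA M lamM = (\<lambda>(a, x).
    witt_map (\<lambda>b. (b, \<zero>\<^bsub>M\<^esub>)) (lamA a)
      \<oplus>\<^bsub>witt_ring (semidirect A M)\<^esub> witt_map (\<lambda>y. (\<zero>\<^bsub>A\<^esub>, y)) (\<lambda>n\<in>{0<..}. lamM n x))"

definition lambda_der ::
    "('a, 'm) ring_scheme \<Rightarrow> ('a \<Rightarrow> nat \<Rightarrow> 'a) \<Rightarrow> ('a, 'b, 'n) module_scheme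
      \<Rightarrow> (nat \<Rightarrow> 'b \<Rightarrow> 'b) \<Rightarrow> ('a \<Rightarrow> 'b) set"
  where "lambda_der A lamA M lamM =
    {D \<in> carrier A \<rightarrow>\<^sub>E carrier M.
       (\<forall>a\<in>carrier A. \<forall>b\<in>carrier A. D (a \<oplus>\<^bsub>A\<^esub> b) = D a \<oplus>\<^bsub>M\<^esub> D b) \<and>
       (\<forall>a\<in>carrier A. \<forall>b\<in>carrier A. D (a \<otimes>\<^bsub>A\<^esub> b) = b \<odot>\<^bsub>M\<^esub> D a \<oplus>\<^bsub>M\<^esub> a \<odot>\<^bsub>M\<^esub> D b) \<and>
       (\<forall>a\<in>carrier A. \<forall>n>0. lamM n (D a) =
          (\<Oplus>\<^bsub>M\<^esub>e\<in>{e. e dvd n}. (lamA a e [^]\<^bsub>A\<^esub> (n div e - 1)) \<odot>\<^bsub>M\<^esub> D (lamA a e)))}"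

end

theory Submission
  imports Defs "HOL-Computational_Algebra.Formal_Power_Series"
begin

text \<open>
  Write the Witt vector sum of \<open>in\<^sub>1 u\<close> and \<open>in\<^sub>2 v\<close> in the square-zero extension as \<open>(u\<^sub>n, t\<^sub>n)\<^sub>n\<close>.
  As squares of elements of \<open>M\<close> vanish, the \<open>n\<close>th ghost equation has \<open>M\<close>-component
  \<open>n \<Sum>\<^bsub>e|n\<^esub> u\<^sub>e\<^bsup>n/e-1\<^esup> t\<^sub>e = n v\<^sub>n\<close>. The factor \<open>n\<close> can be cancelled in the universal case, so
  \<open>v\<^sub>n = \<Sum>\<^bsub>e|n\<^esub> u\<^sub>e\<^bsup>n/e-1\<^esup> t\<^sub>e\<close>, a system which is unitriangular in \<open>t\<close>. With \<open>u = \<lambda>\<^sub>A(a)\<close> and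
  \<open>v = \<lambda>\<^sub>M(D a)\<close>, compatibility of \<open>(id, D)\<close> with the \<open>\<lambda>\<close>-structures says \<open>t\<^sub>n = D(\<lambda>\<^bsub>A,n\<^esub>(a))\<close>, which is
  therefore the defining equation of a derivation.

  The universal addition polynomials \<open>s\<^sub>n\<close> are obtained without divisibility arguments from
  \<open>\<Prod>(1 - s\<^sub>n X\<^sup>n) = \<Prod>(1 - x\<^sub>n X\<^sup>n)(1 - y\<^sub>n X\<^sup>n)\<close>.
\<close>

section \<open>Ghost components and power series\<close>

text \<open>Finite stand-in for the infinite product of the factors \<open>1 - a_i X^i\<close>,
  which encodes a Witt vector as a power series: factors with \<open>i > N\<close> do not affect the
  coefficients up to \<open>X^N\<close>.\<close>

definition euler_prod :: "(nat \<Rightarrow> 'a::comm_ring_1) \<Rightarrow> nat \<Rightarrow> 'a fps"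
  where "euler_prod a N = (\<Prod>i\<in>{0<..N}. 1 - fps_const (a i) * fps_X ^ i)"

text \<open>For \<open>0 < m \<le> N\<close> the coefficient at \<open>X^m\<close> is the
  \<open>m\<close>th ghost component; for larger \<open>m\<close> the divisors beyond
  \<open>N\<close> are missing. The condition \<open>0 < m\<close> clears the constant term, since
  every \<open>i\<close> divides 0.\<close>

definition ghost_fps :: "(nat \<Rightarrow> 'a::comm_ring_1) \<Rightarrow> nat \<Rightarrow> 'a fps"
  where "ghost_fps a N =
    Abs_fps (\<lambda>m. \<Sum>i\<in>{i\<in>{0<..N}. i dvd m \<and> 0 < m}. of_nat i * a i ^ (m div i))"

lemma euler_prod_Suc:
  "euler_prod a (Suc N) = euler_prod a N * (1 - fps_const (a (Suc N)) * fps_X ^ Suc N)"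
proof -
  have "{0<..Suc N} = insert (Suc N) {0<..N}" by auto
  then show ?thesis by (simp add: euler_prod_def mult.commute)
qed

lemma fps_nth_mult_one_minus_monom:
  fixes f :: "'a::comm_ring_1 fps"
  shows "fps_nth (f * (1 - fps_const c * fps_X ^ n)) k =
    fps_nth f k - (if k < n then 0 else fps_nth f (k - n) * c)"
proof -
  have "f * (1 - fps_const c * fps_X ^ n) = f - (f * fps_const c) * fps_X ^ n"
    by (simp add: algebra_simps)
  then show ?thesis by (simp add: fps_X_power_mult_right_nth)
qed

lemma euler_prod_nth_0: "fps_nth (euler_prod a N) 0 = 1"
  by (induction N) (simp add: euler_prod_def, simp add: euler_prod_Suc)

text \<open>
  The logarithmic derivative of \<open>\<Prod>(1 - a\<^sub>i X\<^sup>i)\<close> is, up to sign and a factor \<open>X\<close>,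
  the generating function of the ghost components.
\<close>

lemma euler_prod_log_deriv:
  "fps_X * fps_deriv (euler_prod a N) = - (euler_prod a N * ghost_fps a N)"
proof (induction N)
  case 0
  have "ghost_fps a 0 = 0" by (simp add: ghost_fps_def fps_eq_iff)
  then show ?case by (simp add: euler_prod_def)
next
  case (Suc N)
  define n c where "n = Suc N" and "c = a n"
  define P where "P = euler_prod a N"
  define q where "q = 1 - fps_const c * fps_X ^ n"
  \<comment> \<open>The geometric series \<open>n (c X^n + c^2 X^(2n) + ...)\<close>, that is,
    \<open>n c X^n / (1 - c X^n)\<close>. It is what the new factor contributes, and its product
    with \<open>q\<close> telescopes to one term.\<close>
  define g where "g = Abs_fps (\<lambda>m. if n dvd m \<and> 0 < m then of_nat n * c ^ (m div n) else 0)"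
  have g: "ghost_fps a n = ghost_fps a N + g"
  proof (rule fps_ext)
    fix m
    show "fps_nth (ghost_fps a n) m = fps_nth (ghost_fps a N + g) m"
    proof (cases "n dvd m \<and> 0 < m")
      case True
      then have "{i\<in>{0<..n}. i dvd m \<and> 0 < m} = insert n {i\<in>{0<..N}. i dvd m \<and> 0 < m}"
        by (auto simp: n_def)
      then show ?thesis using True
        by (simp add: ghost_fps_def g_def n_def c_def)
    next
      case False
      then have "{i\<in>{0<..n}. i dvd m \<and> 0 < m} = {i\<in>{0<..N}. i dvd m \<and> 0 < m}"
        by (auto simp: n_def le_Suc_eq)
      then show ?thesis using False by (auto simp: ghost_fps_def g_def)
    qed
  qed
  have "g * q = fps_const (of_nat n * c) * fps_X ^ n"
  proof (rule fps_ext)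
    fix k
    show "fps_nth (g * q) k = fps_nth (fps_const (of_nat n * c) * fps_X ^ n) k"
    proof (cases "n dvd k \<and> n < k")
      case True
      then obtain j where j: "k = n * j" by blast
      with True have "1 < j" by simp
      then obtain i where i: "j = Suc (Suc i)" by (auto simp: less_iff_Suc_add)
      have "n > 0" by (simp add: n_def)
      moreover have "k - n = n * Suc i" using j i by simp
      ultimately show ?thesis using True j i
        unfolding q_def fps_nth_mult_one_minus_monom fps_X_power_mult_right_nth
        by (simp add: g_def algebra_simps)
    next
      case False
      have "n > 0" by (simp add: n_def)
      then show ?thesis using False
        unfolding q_def fps_nth_mult_one_minus_monom fps_X_power_mult_right_nth
        by (auto simp: g_def dvd_minus_self dest: dvd_imp_le)
    qed
  qed
  moreover have "fps_X * fps_deriv q = - (fps_const (of_nat n * c) * fps_X ^ n)"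
  proof (rule fps_ext)
    fix k
    show "fps_nth (fps_X * fps_deriv q) k = fps_nth (- (fps_const (of_nat n * c) * fps_X ^ n)) k"
      by (cases k) (auto simp: q_def n_def fps_X_power_iff algebra_simps)
  qed
  ultimately have q: "fps_X * fps_deriv q = - (g * q)" by simp
  have "fps_X * fps_deriv (P * q) = P * (fps_X * fps_deriv q) + (fps_X * fps_deriv P) * q"
    by (simp add: algebra_simps)
  also have "\<dots> = - (P * q * (ghost_fps a N + g))"
    using Suc q by (simp add: P_def algebra_simps)
  finally show ?case using g
    by (simp add: euler_prod_Suc P_def q_def n_def c_def)
qed

section \<open>Power series compared up to a given degree\<close>

lemma fps_mult_nth_eq_upto:
  fixes f f' g g' :: "'a::comm_ring_1 fps"
  assumes "\<And>k. k \<le> N \<Longrightarrow> fps_nth f k = fps_nth f' k" "\<And>k. k \<le> N \<Longrightarrow> fps_nth g k = fps_nth g' k" "k \<le> N"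
  shows "fps_nth (f * g) k = fps_nth (f' * g') k"
  using assms by (auto simp: fps_mult_nth intro!: sum.cong)

text \<open>The coefficient of \<open>f * u\<close> at \<open>k\<close> is that of \<open>u\<close>
  plus terms in lower coefficients of \<open>u\<close>, because \<open>f\<close> has constant term
  1. Induction on \<open>k\<close> then cancels \<open>f\<close> without inverting it.\<close>

lemma fps_mult_nth_cancel_upto:
  fixes f g h :: "'a::comm_ring_1 fps"
  assumes f: "fps_nth f 0 = 1" and eq: "\<And>k. k \<le> N \<Longrightarrow> fps_nth (f * g) k = fps_nth (f * h) k"
  shows "k \<le> N \<Longrightarrow> fps_nth g k = fps_nth h k"
proof (induction k rule: less_induct)
  case (less k)
  have "fps_nth (f * u) k = fps_nth u k + (\<Sum>i\<in>{0<..k}. fps_nth f i * fps_nth u (k - i))"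
    for u :: "'a fps"
  proof -
    have "{0..k} = insert 0 {0<..k}" by auto
    then show ?thesis using f by (simp add: fps_mult_nth)
  qed
  moreover have "(\<Sum>i\<in>{0<..k}. fps_nth f i * fps_nth g (k - i)) =
      (\<Sum>i\<in>{0<..k}. fps_nth f i * fps_nth h (k - i))"
    using less by (intro sum.cong) auto
  ultimately show ?case using eq[OF less.prems] by simp
qed

text \<open>The factor \<open>1 - s_n X^n\<close> lowers the coefficient at \<open>X^n\<close> of
  the product over \<open>i < n\<close> by exactly \<open>s_n\<close>, so matching this coefficient
  determines \<open>s_n\<close>. No division occurs, which makes the recursion available over every
  commutative ring.\<close>

function witt_sum :: "(nat \<Rightarrow> 'a::comm_ring_1) \<Rightarrow> (nat \<Rightarrow> 'a) \<Rightarrow> nat \<Rightarrow> 'a" where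
  "witt_sum x y n =
    fps_nth (\<Prod>i\<in>{0<..<n}. 1 - fps_const (witt_sum x y i) * fps_X ^ i) n
      - fps_nth (euler_prod x n * euler_prod y n) n"
  by auto
termination by (relation "measure (\<lambda>(x, y, n). n)") auto

declare witt_sum.simps [simp del]

text \<open>A further factor leaves all lower coefficients alone, and the recursion for
  \<open>witt_sum\<close> is made so that the coefficient at the new index comes out right.\<close>

lemma euler_prod_witt_sum:
  "k \<le> N \<Longrightarrow>
    fps_nth (euler_prod (witt_sum x y) N) k = fps_nth (euler_prod x N * euler_prod y N) k"
proof (induction N arbitrary: k)
  case 0
  then show ?case by (simp add: euler_prod_def)
next
  case (Suc N)
  define n where "n = Suc N"
  have "{0<..<n} = {0<..N}" by (auto simp: n_def)
  then have s: "witt_sum x y n =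
      fps_nth (euler_prod (witt_sum x y) N) n - fps_nth (euler_prod x n * euler_prod y n) n"
    by (subst witt_sum.simps) (simp add: euler_prod_def)
  have l: "fps_nth (euler_prod a n) j = fps_nth (euler_prod a N) j" if "j < n" for a :: "nat \<Rightarrow> 'a" and j
    using that by (simp only: n_def euler_prod_Suc fps_nth_mult_one_minus_monom) simp
  show ?case
  proof (cases "k = n")
    case True
    have "fps_nth (euler_prod (witt_sum x y) n) n =
        fps_nth (euler_prod (witt_sum x y) N) n - witt_sum x y n"
      by (simp only: n_def euler_prod_Suc fps_nth_mult_one_minus_monom) (simp add: euler_prod_nth_0)
    then show ?thesis using s True by (simp add: n_def)
  next
    case False
    with Suc.prems have k: "k \<le> N" by (simp add: n_def)
    then have "fps_nth (euler_prod (witt_sum x y) n) k = fps_nth (euler_prod x N * euler_prod y N) k"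
      using Suc.IH l by (simp add: n_def)
    also have "\<dots> = fps_nth (euler_prod x n * euler_prod y n) k"
      using l k by (intro fps_mult_nth_eq_upto[where N = N]) (auto simp: n_def)
    finally show ?thesis by (simp add: n_def)
  qed
qed

text \<open>The logarithmic derivative turns the product of the two series into the sum of their
  ghost series. As the product formula holds only up to \<open>X^n\<close>, the whole comparison is
  made up to that degree.\<close>

lemma ghost_witt_sum:
  fixes x y :: "nat \<Rightarrow> 'a::comm_ring_1"
  assumes n: "n > 0"
  shows "(\<Sum>e\<in>{e. e dvd n}. of_nat e * witt_sum x y e ^ (n div e)) =
    (\<Sum>e\<in>{e. e dvd n}. of_nat e * x e ^ (n div e)) + (\<Sum>e\<in>{e. e dvd n}. of_nat e * y e ^ (n div e))"
proof -
  let ?s = "witt_sum x y"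
  have g: "fps_nth (ghost_fps a n) n = (\<Sum>e\<in>{e. e dvd n}. of_nat e * a e ^ (n div e))"
    for a :: "nat \<Rightarrow> 'a"
  proof -
    \<comment> \<open>Cutting off at \<open>n\<close> loses no divisor of \<open>n\<close>.\<close>
    have "{i\<in>{0<..n}. i dvd n \<and> 0 < n} = {e. e dvd n}"
      using n by (auto intro: dvd_imp_le dvd_pos_nat)
    then show ?thesis by (simp add: ghost_fps_def)
  qed
  define P Q where "P = euler_prod ?s n" and "Q = euler_prod x n * euler_prod y n"
  have PQ: "fps_nth P k = fps_nth Q k" if "k \<le> n" for k
    using euler_prod_witt_sum[OF that, of x y] by (simp add: P_def Q_def)
  have "fps_X * fps_deriv Q = euler_prod x n * (fps_X * fps_deriv (euler_prod y n))
      + (fps_X * fps_deriv (euler_prod x n)) * euler_prod y n"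
    by (simp add: Q_def algebra_simps)
  then have Q: "fps_X * fps_deriv Q = - (Q * (ghost_fps x n + ghost_fps y n))"
    by (simp add: euler_prod_log_deriv Q_def algebra_simps)
  have "fps_nth (P * ghost_fps ?s n) k = fps_nth (P * (ghost_fps x n + ghost_fps y n)) k"
    if k: "k \<le> n" for k
  proof -
    have "fps_nth (P * ghost_fps ?s n) k = - fps_nth (fps_X * fps_deriv P) k"
      by (simp add: P_def euler_prod_log_deriv)
    \<comment> \<open>The factor \<open>X\<close> undoes the shift of the derivative, so the
      coefficient at \<open>k\<close> depends on the coefficient of \<open>P\<close> at the same
      \<open>k\<close> only.\<close>
    also have "\<dots> = - fps_nth (fps_X * fps_deriv Q) k"
      using PQ k by (cases k) simp_all
    also have "\<dots> = fps_nth (Q * (ghost_fps x n + ghost_fps y n)) k"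
      by (simp add: Q)
    also have "\<dots> = fps_nth (P * (ghost_fps x n + ghost_fps y n)) k"
      using PQ k by (intro fps_mult_nth_eq_upto[where N = n]) auto
    finally show ?thesis .
  qed
  then have "fps_nth (ghost_fps ?s n) n = fps_nth (ghost_fps x n + ghost_fps y n) n"
    by (rule fps_mult_nth_cancel_upto[where f = P and N = n, rotated])
      (simp_all add: P_def euler_prod_nth_0)
  then show ?thesis by (simp add: g)
qed

section \<open>Universal polynomials for Witt vector addition\<close>

lemma ipoly_ring_cring: "cring (ipoly_ring :: 'v ipoly ring)"
proof (intro cringI abelian_groupI comm_monoidI)
  fix p :: "'v ipoly"
  show "\<exists>q\<in>carrier ipoly_ring. q \<oplus>\<^bsub>ipoly_ring\<^esub> p = \<zero>\<^bsub>ipoly_ring\<^esub>"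
    by (rule bexI[of _ "- p"]) (simp_all add: ipoly_ring_def)
qed (simp_all add: ipoly_ring_def algebra_simps)

lemma ipoly_ring_nat_pow: "p [^]\<^bsub>ipoly_ring\<^esub> (n::nat) = p ^ n"
  by (induction n) (simp_all add: nat_pow_def ipoly_ring_def mult.commute)

lemma ipoly_ring_add_pow:
  fixes n :: nat
  shows "[n] \<cdot>\<^bsub>ipoly_ring\<^esub> p = of_nat n * p"
  by (induction n) (simp_all add: add_pow_def nat_pow_def ipoly_ring_def algebra_simps)

lemma ipoly_ring_finsum:
  fixes f :: "'i \<Rightarrow> 'v ipoly"
  shows "finite A \<Longrightarrow> (\<Oplus>\<^bsub>ipoly_ring\<^esub>i\<in>A. f i) = sum f A"
proof (induction A rule: finite_induct)
  interpret cring "ipoly_ring :: 'v ipoly ring" by (rule ipoly_ring_cring)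
  case empty
  show ?case by (simp, simp add: ipoly_ring_def)
next
  interpret cring "ipoly_ring :: 'v ipoly ring" by (rule ipoly_ring_cring)
  case (insert x A)
  have "f i \<in> carrier ipoly_ring" for i by (simp add: ipoly_ring_def)
  with insert have "(\<Oplus>\<^bsub>ipoly_ring\<^esub>i\<in>insert x A. f i) = f x \<oplus>\<^bsub>ipoly_ring\<^esub> sum f A"
    by (simp add: Pi_iff)
  with insert.hyps show ?case by (simp add: ipoly_ring_def)
qed

lemma witt_ghost_ipoly_ring:
  assumes "n > 0"
  shows "witt_ghost ipoly_ring n a = (\<Sum>e\<in>{e. e dvd n}. of_nat e * a e ^ (n div e))"
  unfolding witt_ghost_def ipoly_ring_nat_pow ipoly_ring_add_pow
  using assms by (intro ipoly_ring_finsum) simp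

lemma lookup_of_nat_mult: "Poly_Mapping.lookup (of_nat n * p) m = of_nat n * Poly_Mapping.lookup (p :: 'v ipoly) m"
  by (induction n) (simp_all add: algebra_simps lookup_add)

text \<open>No integer coefficient is killed by a positive factor. This is the source of every
  division by \<open>n\<close> below: cancelling \<open>n\<close>, and reading off variables and
  weights of \<open>p\<close> from those of \<open>n p\<close>.\<close>

lemma keys_of_nat_mult: "n > 0 \<Longrightarrow> Poly_Mapping.keys (of_nat n * p) = Poly_Mapping.keys (p :: 'v ipoly)"
  by (simp add: set_eq_iff in_keys_iff lookup_of_nat_mult)

lemma ipoly_of_nat_mult_cancel: "n > 0 \<Longrightarrow> of_nat n * p = of_nat n * q \<Longrightarrow> p = (q :: 'v ipoly)"
  using keys_of_nat_mult[of n "p - q"] Poly_Mapping.keys_eq_empty[of "p - q"]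
  by (simp add: right_diff_distrib del: Poly_Mapping.keys_eq_empty)

lemma divisors_split: "n > 0 \<Longrightarrow> {e::nat. e dvd n} = insert n {e. e dvd n \<and> e < n}"
  by (auto dest: dvd_imp_le)

lemma sum_divisors_split:
  fixes f :: "nat \<Rightarrow> 'a::comm_monoid_add"
  assumes "n > 0"
  shows "(\<Sum>e\<in>{e. e dvd n}. f e) = f n + (\<Sum>e\<in>{e. e dvd n \<and> e < n}. f e)"
  using assms by (subst divisors_split) simp_all

text \<open>Once the components at proper divisors are known to agree, the \<open>n\<close>th ghost
  component determines \<open>n * a n\<close>, hence \<open>a n\<close> by torsion freeness.\<close>

lemma ipoly_ghost_inject:
  fixes a b :: "nat \<Rightarrow> 'v ipoly"
  assumes "\<And>n. n > 0 \<Longrightarrow> (\<Sum>e\<in>{e. e dvd n}. of_nat e * a e ^ (n div e)) =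
      (\<Sum>e\<in>{e. e dvd n}. of_nat e * b e ^ (n div e))"
  shows "n > 0 \<Longrightarrow> a n = b n"
proof (induction n rule: less_induct)
  case (less n)
  have "(\<Sum>e\<in>{e. e dvd n \<and> e < n}. of_nat e * a e ^ (n div e)) =
      (\<Sum>e\<in>{e. e dvd n \<and> e < n}. of_nat e * b e ^ (n div e))"
    using less by (intro sum.cong) (auto dest: dvd_pos_nat)
  with assms[OF less.prems] less.prems have "of_nat n * a n = of_nat n * b n"
    by (simp add: sum_divisors_split)
  with less.prems show ?case by (rule ipoly_of_nat_mult_cancel)
qed

text \<open>Justifies the definite description behind \<open>witt_add_poly\<close>:
  \<open>witt_sum\<close> of the two families of variables is a solution, and ghost components
  determine a solution.\<close>

lemma witt_add_poly_ghost:
  assumes "n > 0"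
  shows "(\<Sum>e\<in>{e. e dvd n}. of_nat e * witt_add_poly e ^ (n div e)) =
      (\<Sum>e\<in>{e. e dvd n}. of_nat e * ipoly_var (Inl e) ^ (n div e))
        + (\<Sum>e\<in>{e. e dvd n}. of_nat e * ipoly_var (Inr e) ^ (n div e))"
proof -
  define Q :: "(nat \<Rightarrow> (nat + nat) ipoly) \<Rightarrow> bool" where "Q s \<longleftrightarrow>
    s \<in> witt_carrier ipoly_ring \<and>
       (\<forall>n>0. witt_ghost ipoly_ring n s =
          witt_ghost ipoly_ring n (\<lambda>i. ipoly_var (Inl i))
            \<oplus>\<^bsub>ipoly_ring\<^esub> witt_ghost ipoly_ring n (\<lambda>i. ipoly_var (Inr i)))" for s
  have Q: "Q s \<longleftrightarrow> s \<in> extensional {0<..} \<and>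
    (\<forall>n>0. (\<Sum>e\<in>{e. e dvd n}. of_nat e * s e ^ (n div e)) =
      (\<Sum>e\<in>{e. e dvd n}. of_nat e * ipoly_var (Inl e) ^ (n div e))
        + (\<Sum>e\<in>{e. e dvd n}. of_nat e * ipoly_var (Inr e) ^ (n div e)))" for s
  proof -
    have "carrier (ipoly_ring :: (nat + nat) ipoly ring) = UNIV" "p \<oplus>\<^bsub>ipoly_ring\<^esub> q = p + q" for p q :: "(nat + nat) ipoly"
      by (simp_all add: ipoly_ring_def)
    then show ?thesis
      by (simp add: Q_def witt_carrier_def PiE_def witt_ghost_ipoly_ring)
  qed
  \<comment> \<open>The restriction puts \<open>undefined\<close> at index 0, as membership in
    \<open>witt_carrier\<close> demands.\<close>
  define s :: "nat \<Rightarrow> (nat + nat) ipoly"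
    where "s = restrict (witt_sum (\<lambda>i. ipoly_var (Inl i)) (\<lambda>i. ipoly_var (Inr i))) {0<..}"
  have "(\<Sum>e\<in>{e. e dvd n}. of_nat e * s e ^ (n div e)) =
      (\<Sum>e\<in>{e. e dvd n}. of_nat e * ipoly_var (Inl e) ^ (n div e))
        + (\<Sum>e\<in>{e. e dvd n}. of_nat e * ipoly_var (Inr e) ^ (n div e))" if "n > 0" for n
    unfolding ghost_witt_sum[OF that, symmetric]
    using that by (intro sum.cong) (auto simp: s_def dest: dvd_pos_nat)
  then have "Q s" by (simp add: Q s_def)
  note ghost = Q[THEN iffD1, THEN conjunct2, rule_format]
  have "t = s" if "Q t" for t
  proof (rule extensionalityI[where A = "{0<..}"])
    show "t n = s n" if "n \<in> {0<..}" for n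
      using that by (intro ipoly_ghost_inject[of t s]) (simp_all only: ghost \<open>Q t\<close> \<open>Q s\<close> greaterThan_iff)
  qed (use \<open>Q t\<close> \<open>Q s\<close> in \<open>auto simp: Q\<close>)
  with \<open>Q s\<close> have "Q (THE s. Q s)" by (rule theI)
  also have "(THE s. Q s) = witt_add_poly" unfolding Q_def witt_add_poly_def ..
  finally show ?thesis by (rule ghost[OF _ assms])
qed

section \<open>Variables occurring in the addition polynomials\<close>

definition ipoly_vars :: "'v ipoly \<Rightarrow> 'v set"
  where "ipoly_vars p = (\<Union>m\<in>Poly_Mapping.keys p. Poly_Mapping.keys m)"

lemma ipoly_vars_var: "ipoly_vars (ipoly_var v) = {v}"
  by (simp add: ipoly_vars_def ipoly_var_def)

lemma ipoly_vars_add: "ipoly_vars (p + q) \<subseteq> ipoly_vars p \<union> ipoly_vars q"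
  using keys_add[of p q] by (auto simp: ipoly_vars_def)

lemma ipoly_vars_diff: "ipoly_vars (p - q) \<subseteq> ipoly_vars p \<union> ipoly_vars q"
  using keys_diff[of p q] by (auto simp: ipoly_vars_def)

lemma ipoly_vars_mult: "ipoly_vars (p * q) \<subseteq> ipoly_vars p \<union> ipoly_vars q"
  using keys_mult[of p q] keys_add by (fastforce simp: ipoly_vars_def)

lemma ipoly_vars_of_nat_mult: "ipoly_vars (of_nat n * p) \<subseteq> ipoly_vars p"
  by (cases "n = 0") (simp_all add: ipoly_vars_def keys_of_nat_mult)

lemma ipoly_vars_power: "ipoly_vars (p ^ k) \<subseteq> ipoly_vars p"
proof (induction k)
  case (Suc k)
  then show ?case using ipoly_vars_mult[of p "p ^ k"] by auto
qed (simp add: ipoly_vars_def)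

lemma ipoly_vars_sum: "ipoly_vars (\<Sum>i\<in>A. f i) \<subseteq> (\<Union>i\<in>A. ipoly_vars (f i))"
  using keys_sum[of f A] by (fastforce simp: ipoly_vars_def)

lemma ipoly_vars_ghost:
  "ipoly_vars (\<Sum>e\<in>A. of_nat e * f e ^ g e) \<subseteq> (\<Union>e\<in>A. ipoly_vars (f e))"
  by (rule order_trans[OF ipoly_vars_sum], intro UN_mono order_refl)
    (rule order_trans[OF ipoly_vars_of_nat_mult ipoly_vars_power])

text \<open>
  Needed because the components at \<open>0\<close> of Witt vectors are \<open>undefined\<close>, hence possibly outside
  of the carrier.
\<close>

lemma ipoly_vars_witt_add_poly: "n > 0 \<Longrightarrow> ipoly_vars (witt_add_poly n) \<subseteq> {0<..} <+> {0<..}"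
proof (induction n rule: less_induct)
  case (less n)
  let ?P = "\<lambda>p. ipoly_vars p \<subseteq> {0<..} <+> {0<..}"
  let ?l = "\<Sum>e\<in>{e. e dvd n}. of_nat e * ipoly_var (Inl e) ^ (n div e) :: (nat + nat) ipoly"
  let ?r = "\<Sum>e\<in>{e. e dvd n}. of_nat e * ipoly_var (Inr e) ^ (n div e) :: (nat + nat) ipoly"
  let ?s = "\<Sum>e\<in>{e. e dvd n \<and> e < n}. of_nat e * witt_add_poly e ^ (n div e)"
  have pos: "e > 0" if "e dvd n" for e
    using that less.prems by (rule dvd_pos_nat[rotated])
  have "of_nat n * witt_add_poly n = ?l + ?r - ?s"
    using witt_add_poly_ghost[OF less.prems] less.prems
    by (simp add: sum_divisors_split[OF less.prems, of "\<lambda>e. of_nat e * witt_add_poly e ^ (n div e)"] algebra_simps)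
  \<comment> \<open>Multiplication by \<open>n\<close> does not change the monomials, so the
    equation for \<open>n * witt_add_poly n\<close> bounds the variables of
    \<open>witt_add_poly n\<close> itself.\<close>
  then have "ipoly_vars (witt_add_poly n) = ipoly_vars (?l + ?r - ?s)"
    using keys_of_nat_mult[OF less.prems, of "witt_add_poly n"] by (simp add: ipoly_vars_def)
  moreover have "?P ?l"
    using ipoly_vars_ghost[of "\<lambda>e. ipoly_var (Inl e)" _ "{e. e dvd n}"] pos
    by (fastforce simp: ipoly_vars_var)
  moreover have "?P ?r"
    using ipoly_vars_ghost[of "\<lambda>e. ipoly_var (Inr e)" _ "{e. e dvd n}"] pos
    by (fastforce simp: ipoly_vars_var)
  moreover have "?P ?s"
    using ipoly_vars_ghost[of witt_add_poly _ "{e. e dvd n \<and> e < n}"] less.IH pos by blast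
  ultimately show ?case
    using ipoly_vars_diff[of "?l + ?r" ?s] ipoly_vars_add[of ?l ?r] by blast
qed

section \<open>Filtration of polynomials by weight\<close>

definition monom_weight :: "('v \<Rightarrow> nat) \<Rightarrow> ('v \<Rightarrow>\<^sub>0 nat) \<Rightarrow> nat"
  where "monom_weight c m = (\<Sum>v\<in>Poly_Mapping.keys m. c v * Poly_Mapping.lookup m v)"

definition ipoly_filtration :: "('v \<Rightarrow> nat) \<Rightarrow> nat \<Rightarrow> 'v ipoly set"
  where "ipoly_filtration c k = {p. \<forall>m\<in>Poly_Mapping.keys p. k \<le> monom_weight c m}"

lemma monom_weight_superset:
  "finite K \<Longrightarrow> Poly_Mapping.keys m \<subseteq> K \<Longrightarrow> monom_weight c m = (\<Sum>v\<in>K. c v * Poly_Mapping.lookup m v)"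
  unfolding monom_weight_def by (rule sum.mono_neutral_left) (auto simp: in_keys_iff)

lemma monom_weight_add: "monom_weight c (m + m') = monom_weight c m + monom_weight c m'"
  using keys_add[of m m']
  by (simp add: monom_weight_superset[of "Poly_Mapping.keys m \<union> Poly_Mapping.keys m'"] lookup_add algebra_simps sum.distrib)

lemma ipoly_filtration_0: "p \<in> ipoly_filtration c 0"
  by (simp add: ipoly_filtration_def)

lemma ipoly_filtration_zero: "0 \<in> ipoly_filtration c k"
  by (simp add: ipoly_filtration_def)

lemma ipoly_filtration_var: "ipoly_var v \<in> ipoly_filtration c (c v)"
  by (simp add: ipoly_filtration_def ipoly_var_def monom_weight_def)

lemma ipoly_filtration_antimono: "j \<le> k \<Longrightarrow> ipoly_filtration c k \<subseteq> ipoly_filtration c j"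
  by (auto simp: ipoly_filtration_def)

lemma ipoly_filtration_add:
  "p \<in> ipoly_filtration c k \<Longrightarrow> q \<in> ipoly_filtration c k \<Longrightarrow> p + q \<in> ipoly_filtration c k"
  using keys_add[of p q] by (auto simp: ipoly_filtration_def)

lemma ipoly_filtration_diff:
  "p \<in> ipoly_filtration c k \<Longrightarrow> q \<in> ipoly_filtration c k \<Longrightarrow> p - q \<in> ipoly_filtration c k"
  using keys_diff[of p q] by (auto simp: ipoly_filtration_def)

lemma ipoly_filtration_mult:
  "p \<in> ipoly_filtration c j \<Longrightarrow> q \<in> ipoly_filtration c k \<Longrightarrow> p * q \<in> ipoly_filtration c (j + k)"
  using keys_mult[of p q] by (fastforce simp: ipoly_filtration_def monom_weight_add intro: add_mono)

lemma ipoly_filtration_mult_left: "q \<in> ipoly_filtration c k \<Longrightarrow> p * q \<in> ipoly_filtration c k"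
  using ipoly_filtration_mult[OF ipoly_filtration_0] by simp

lemma ipoly_filtration_sum:
  "(\<And>i. i \<in> A \<Longrightarrow> f i \<in> ipoly_filtration c k) \<Longrightarrow> (\<Sum>i\<in>A. f i) \<in> ipoly_filtration c k"
  by (induction A rule: infinite_finite_induct)
    (simp_all add: ipoly_filtration_add ipoly_filtration_zero)

lemma ipoly_filtration_of_nat_mult_cancel:
  "n > 0 \<Longrightarrow> of_nat n * p \<in> ipoly_filtration c k \<Longrightarrow> p \<in> ipoly_filtration c k"
  by (simp add: ipoly_filtration_def keys_of_nat_mult)

lemma ipoly_filtration_power:
  "p \<in> ipoly_filtration c k \<Longrightarrow> p ^ n \<in> ipoly_filtration c (n * k)"
proof (induction n)
  case (Suc n)
  then show ?case using ipoly_filtration_mult[of p c k "p ^ n" "n * k"] by simp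
qed (simp add: ipoly_filtration_0)

lemma ipoly_filtration_power_diff:
  assumes "p - q \<in> ipoly_filtration c k"
  shows "p ^ n - q ^ n \<in> ipoly_filtration c k"
proof (induction n)
  case (Suc n)
  have "p ^ Suc n - q ^ Suc n = p * (p ^ n - q ^ n) + q ^ n * (p - q)"
    by (simp add: algebra_simps)
  with Suc assms show ?case
    by (simp only:) (intro ipoly_filtration_add ipoly_filtration_mult_left)
qed (simp add: ipoly_filtration_zero)

text \<open>First-order Taylor expansion of the \<open>n\<close>th power at \<open>q\<close>, with a
  remainder of second order in \<open>p - q\<close>. For \<open>n = 0\<close> the truncated exponent
  \<open>n - 1\<close> is harmless, its term carrying the factor 0.\<close>

lemma ipoly_filtration_power_diff_linear:
  assumes "p - q \<in> ipoly_filtration c k"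
  shows "p ^ n - q ^ n - of_nat n * q ^ (n - 1) * (p - q) \<in> ipoly_filtration c (k + k)"
proof (cases n)
  case (Suc l)
  have "p ^ Suc l - q ^ Suc l - of_nat (Suc l) * q ^ l * (p - q) \<in> ipoly_filtration c (k + k)"
  proof (induction l)
    case (Suc l)
    have "p ^ Suc (Suc l) - q ^ Suc (Suc l) - of_nat (Suc (Suc l)) * q ^ Suc l * (p - q) =
        q * (p ^ Suc l - q ^ Suc l - of_nat (Suc l) * q ^ l * (p - q))
          + (p - q) * (p ^ Suc l - q ^ Suc l)"
      by (simp add: algebra_simps)
    with Suc assms show ?case
      by (simp only:) (intro ipoly_filtration_add ipoly_filtration_mult_left
          ipoly_filtration_mult ipoly_filtration_power_diff)
  qed (simp add: ipoly_filtration_zero)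
  with Suc show ?thesis by simp
qed (simp add: ipoly_filtration_zero)

text \<open>Degree in the components of the second summand. In the square-zero extension these take
  values in the ideal \<open>M\<close>, so weight 1 means lying in \<open>M\<close> and weight 2
  means vanishing.\<close>

definition snd_weight :: "nat + nat \<Rightarrow> nat"
  where "snd_weight = case_sum (\<lambda>_. 0) (\<lambda>_. 1)"

lemma snd_weight_simps [simp]: "snd_weight (Inl i) = 0" "snd_weight (Inr i) = 1"
  by (simp_all add: snd_weight_def)

text \<open>Adding the zero Witt vector changes nothing. In the ghost equation, \<open>n\<close>
  times the difference is a combination of powers of second variables and of terms divisible by
  earlier differences; weights survive division by \<open>n\<close>.\<close>

lemma witt_add_poly_first_order:
  "n > 0 \<Longrightarrow> witt_add_poly n - ipoly_var (Inl n) \<in> ipoly_filtration snd_weight 1"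
proof (induction n rule: less_induct)
  case (less n)
  let ?x = "\<lambda>e. ipoly_var (Inl e) :: (nat + nat) ipoly"
  let ?y = "\<lambda>e. ipoly_var (Inr e) :: (nat + nat) ipoly"
  have pos: "e > 0" if "e dvd n" for e
    using that less.prems by (rule dvd_pos_nat[rotated])
  have "of_nat n * (witt_add_poly n - ?x n) =
      (\<Sum>e\<in>{e. e dvd n}. of_nat e * ?y e ^ (n div e))
        - (\<Sum>e\<in>{e. e dvd n \<and> e < n}. of_nat e * (witt_add_poly e ^ (n div e) - ?x e ^ (n div e)))"
    using witt_add_poly_ghost[OF less.prems] less.prems
    by (simp add: sum_divisors_split[OF less.prems] algebra_simps sum_subtractf)
  also have "\<dots> \<in> ipoly_filtration snd_weight 1"
  proof (rule ipoly_filtration_diff; intro ipoly_filtration_sum ipoly_filtration_mult_left)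
    fix e assume "e \<in> {e. e dvd n}"
    then have "1 \<le> n div e"
      using less.prems by (auto simp: Suc_le_eq div_greater_zero_iff dest: dvd_imp_le pos)
    moreover have "?y e ^ (n div e) \<in> ipoly_filtration snd_weight (n div e * 1)"
      using ipoly_filtration_var[of "Inr e" snd_weight] by (intro ipoly_filtration_power) simp
    ultimately show "?y e ^ (n div e) \<in> ipoly_filtration snd_weight 1"
      using ipoly_filtration_antimono by fastforce
  qed (use less.IH pos in \<open>auto intro!: ipoly_filtration_power_diff\<close>)
  finally show ?case by (rule ipoly_filtration_of_nat_mult_cancel[OF less.prems])
qed

text \<open>
  Modulo terms of order two in the second argument, the ghost equation is divisible by \<open>n\<close>,
  which gives the linear part of Witt vector addition.
\<close>

lemma witt_add_poly_second_order:
  assumes n: "n > 0"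
  shows "(\<Sum>e\<in>{e. e dvd n}. ipoly_var (Inl e) ^ (n div e - 1) * (witt_add_poly e - ipoly_var (Inl e)))
      - ipoly_var (Inr n) \<in> ipoly_filtration snd_weight 2"
proof -
  let ?x = "\<lambda>e. ipoly_var (Inl e) :: (nat + nat) ipoly"
  let ?y = "\<lambda>e. ipoly_var (Inr e) :: (nat + nat) ipoly"
  let ?T = "\<lambda>e. witt_add_poly e - ?x e"
  have pos: "e > 0" if "e dvd n" for e
    using that n by (rule dvd_pos_nat[rotated])
  \<comment> \<open>The linear term in the expansion of \<open>witt_add_poly e ^ (n div e)\<close>
    at \<open>?x e\<close>.\<close>
  define L where "L e = of_nat (n div e) * ?x e ^ (n div e - 1) * ?T e" for e
  have lin: "of_nat n * (\<Sum>e\<in>{e. e dvd n}. ?x e ^ (n div e - 1) * ?T e) =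
      (\<Sum>e\<in>{e. e dvd n}. of_nat e * L e)"
    unfolding L_def sum_distrib_left
  proof (intro sum.cong refl)
    fix e assume "e \<in> {e. e dvd n}"
    \<comment> \<open>The weight \<open>e\<close> of the ghost component and the derivative factor
      \<open>n/e\<close> multiply to \<open>n\<close> for every divisor, which gives all linear
      terms the common factor \<open>n\<close>.\<close>
    then have "of_nat n = (of_nat e * of_nat (n div e) :: (nat + nat) ipoly)"
      by (metis mem_Collect_eq dvd_mult_div_cancel of_nat_mult)
    then show "of_nat n * (?x e ^ (n div e - 1) * ?T e) =
        of_nat e * (of_nat (n div e) * ?x e ^ (n div e - 1) * ?T e)"
      by (simp only: mult.assoc)
  qed
  have y: "(\<Sum>e\<in>{e. e dvd n}. of_nat e * ?y e ^ (n div e)) =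
      of_nat n * ?y n + (\<Sum>e\<in>{e. e dvd n \<and> e < n}. of_nat e * ?y e ^ (n div e))"
    using n by (simp add: sum_divisors_split)
  have "of_nat n * ((\<Sum>e\<in>{e. e dvd n}. ?x e ^ (n div e - 1) * ?T e) - ?y n) =
      (\<Sum>e\<in>{e. e dvd n}. of_nat e * L e) - of_nat n * ?y n"
    unfolding lin[symmetric] by (rule right_diff_distrib)
  \<comment> \<open>The ghost equation cancels \<open>n y_n\<close>. What remains are powers
    \<open>y_e^(n/e)\<close> with \<open>n/e \<ge> 2\<close> and the second-order remainders of the
    expansions.\<close>
  also have "\<dots> = (\<Sum>e\<in>{e. e dvd n \<and> e < n}. of_nat e * ?y e ^ (n div e))
      - (\<Sum>e\<in>{e. e dvd n}. of_nat e * (witt_add_poly e ^ (n div e) - ?x e ^ (n div e) - L e))"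
    using witt_add_poly_ghost[OF n]
    unfolding y by (simp add: right_diff_distrib sum_subtractf)
  also have "\<dots> \<in> ipoly_filtration snd_weight 2"
  proof (rule ipoly_filtration_diff; intro ipoly_filtration_sum ipoly_filtration_mult_left)
    fix e assume e: "e \<in> {e. e dvd n \<and> e < n}"
    then obtain k where k: "n = e * k" by blast
    with e n have "2 \<le> n div e" by (cases k; cases "k - 1") auto
    moreover have "?y e ^ (n div e) \<in> ipoly_filtration snd_weight (n div e * 1)"
      using ipoly_filtration_var[of "Inr e" snd_weight] by (intro ipoly_filtration_power) simp
    ultimately show "?y e ^ (n div e) \<in> ipoly_filtration snd_weight 2"
      using ipoly_filtration_antimono by fastforce
  next
    fix e assume "e \<in> {e. e dvd n}"
    then show "witt_add_poly e ^ (n div e) - ?x e ^ (n div e) - L e \<in> ipoly_filtration snd_weight 2"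
      using ipoly_filtration_power_diff_linear[OF witt_add_poly_first_order[of e]] pos
      by (simp add: numeral_2_eq_2 L_def)
  qed
  finally show ?thesis by (rule ipoly_filtration_of_nat_mult_cancel[OF n])
qed

section \<open>Evaluation in the square-zero extension\<close>

definition monom_eval :: "('a, 'm) ring_scheme \<Rightarrow> ('v \<Rightarrow> 'a) \<Rightarrow> ('v \<Rightarrow>\<^sub>0 nat) \<Rightarrow> 'a"
  where "monom_eval R a m =
    (\<Otimes>\<^bsub>R\<^esub>v\<in>Poly_Mapping.keys m. a v [^]\<^bsub>R\<^esub> Poly_Mapping.lookup m v)"

lemma ipoly_induct [case_names zero single add]:
  fixes p :: "'v ipoly"
  assumes "P 0" "\<And>m c. P (Poly_Mapping.single m c)" "\<And>p q. P p \<Longrightarrow> P q \<Longrightarrow> P (p + q)"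
  shows "P p"
proof (induction p rule: Poly_Mapping.update_induct)
  case (update p m c)
  have "Poly_Mapping.update m c p = Poly_Mapping.single m c + p"
    using update.hyps
    by (intro poly_mapping_eqI)
      (auto simp: Poly_Mapping.lookup_update lookup_add lookup_single in_keys_iff when_def)
  with update assms show ?case by simp
qed (rule assms)

lemma add_pow_int_zero: "add_pow R (0::int) x = \<zero>\<^bsub>R\<^esub>"
  by (simp add: add_pow_def)

context cring
begin

context
  fixes a :: "'v \<Rightarrow> 'a"
  assumes a: "\<And>v. a v \<in> carrier R"
begin

lemma monom_eval_superset:
  "finite K \<Longrightarrow> Poly_Mapping.keys m \<subseteq> K \<Longrightarrow>
    monom_eval R a m = (\<Otimes>v\<in>K. a v [^] Poly_Mapping.lookup m v)"
  unfolding monom_eval_def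
  by (rule finprod_mono_neutral_cong_left) (auto simp: in_keys_iff a)

lemma monom_eval_closed: "monom_eval R a m \<in> carrier R"
  unfolding monom_eval_def by (rule finprod_closed) (simp add: a)

lemma monom_eval_add: "monom_eval R a (m + m') = monom_eval R a m \<otimes> monom_eval R a m'"
  using Poly_Mapping.keys_add[of m m']
  by (simp add: monom_eval_superset[of "Poly_Mapping.keys m \<union> Poly_Mapping.keys m'"] lookup_add a
      nat_pow_mult[symmetric])

lemma monom_eval_single: "monom_eval R a (Poly_Mapping.single v n) = a v [^] n"
  by (simp add: monom_eval_superset[of "{v}"] a)

lemma ipoly_eval_superset:
  "finite K \<Longrightarrow> Poly_Mapping.keys p \<subseteq> K \<Longrightarrow>
    ipoly_eval R a p = (\<Oplus>m\<in>K. [Poly_Mapping.lookup p m] \<cdot> monom_eval R a m)"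
  unfolding ipoly_eval_def monom_eval_def[symmetric]
  by (rule add.finprod_mono_neutral_cong_left)
    (auto simp: in_keys_iff monom_eval_closed add_pow_int_zero)

lemma ipoly_eval_closed: "ipoly_eval R a p \<in> carrier R"
  unfolding ipoly_eval_def monom_eval_def[symmetric]
  by (rule finsum_closed) (simp add: monom_eval_closed)

lemma ipoly_eval_add: "ipoly_eval R a (p + q) = ipoly_eval R a p \<oplus> ipoly_eval R a q"
  using Poly_Mapping.keys_add[of p q]
  by (simp add: ipoly_eval_superset[of "Poly_Mapping.keys p \<union> Poly_Mapping.keys q"] lookup_add
      monom_eval_closed add.int_pow_mult)

lemma ipoly_eval_zero: "ipoly_eval R a 0 = \<zero>"
  by (simp add: ipoly_eval_def)

lemma ipoly_eval_single: "ipoly_eval R a (Poly_Mapping.single m c) = [c] \<cdot> monom_eval R a m"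
  by (simp add: ipoly_eval_superset[of "{m}"] monom_eval_closed)

lemma ipoly_eval_mult: "ipoly_eval R a (p * q) = ipoly_eval R a p \<otimes> ipoly_eval R a q"
proof (induction p rule: ipoly_induct)
  case (single m c)
  show ?case
  proof (induction q rule: ipoly_induct)
    case (single m' d)
    show ?case
      by (simp add: mult_single ipoly_eval_single monom_eval_add monom_eval_closed
          add_pow_ldistr_int add_pow_rdistr_int add.int_pow_pow mult.commute m_comm)
  qed (simp_all add: ipoly_eval_zero ipoly_eval_add ipoly_eval_closed distrib_left r_distr)
qed (simp_all add: ipoly_eval_zero ipoly_eval_add ipoly_eval_closed distrib_right l_distr)

lemma ipoly_eval_var: "ipoly_eval R a (ipoly_var v) = a v"
  by (simp add: ipoly_var_def ipoly_eval_single monom_eval_single a add.int_pow_1)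

lemma ipoly_eval_power: "ipoly_eval R a (p ^ n) = ipoly_eval R a p [^] n"
proof (induction n)
  case 0
  have "ipoly_eval R a (Poly_Mapping.single 0 1) = \<one>"
    by (simp only: ipoly_eval_single) (simp add: monom_eval_def add.int_pow_1)
  then show ?case by simp
qed (simp add: ipoly_eval_mult ipoly_eval_closed m_comm)

end

text \<open>Lets a Witt vector, possibly outside the carrier at index 0, be replaced by an
  assignment with all its values in the carrier, as the other evaluation lemmas require.\<close>

lemma ipoly_eval_cong:
  assumes "\<And>v. v \<in> ipoly_vars p \<Longrightarrow> a v = b v" "\<And>v. b v \<in> carrier R"
  shows "ipoly_eval R a p = ipoly_eval R b p"
proof -
  have "monom_eval R a m = monom_eval R b m" if "m \<in> Poly_Mapping.keys p" for m
  proof -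
    have "a v = b v" if "v \<in> Poly_Mapping.keys m" for v
      using that \<open>m \<in> Poly_Mapping.keys p\<close> by (intro assms(1)) (auto simp: ipoly_vars_def)
    then show ?thesis
      unfolding monom_eval_def by (intro finprod_cong') (auto simp: assms(2))
  qed
  then show ?thesis
    unfolding ipoly_eval_def monom_eval_def[symmetric]
    by (intro finsum_cong') (auto simp: monom_eval_closed assms)
qed

end

section \<open>Square-zero extension and values of polynomials in it\<close>

context Module.module
begin

context
  fixes S defines "S \<equiv> semidirect R M"
begin

lemma semidirect_simps:
  "carrier S = carrier R \<times> carrier M"
  "p \<otimes>\<^bsub>S\<^esub> q = (fst p \<otimes> fst q, fst p \<odot>\<^bsub>M\<^esub> snd q \<oplus>\<^bsub>M\<^esub> fst q \<odot>\<^bsub>M\<^esub> snd p)"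
  "\<one>\<^bsub>S\<^esub> = (\<one>, \<zero>\<^bsub>M\<^esub>)"
  "\<zero>\<^bsub>S\<^esub> = (\<zero>, \<zero>\<^bsub>M\<^esub>)"
  "p \<oplus>\<^bsub>S\<^esub> q = (fst p \<oplus> fst q, snd p \<oplus>\<^bsub>M\<^esub> snd q)"
  by (simp_all add: S_def semidirect_def case_prod_unfold)

lemma semidirect_cring: "cring S"
proof (intro cringI abelian_groupI comm_monoidI)
  fix p assume "p \<in> carrier S"
  then show "\<exists>q\<in>carrier S. q \<oplus>\<^bsub>S\<^esub> p = \<zero>\<^bsub>S\<^esub>"
    by (intro bexI[of _ "(\<ominus> fst p, \<ominus>\<^bsub>M\<^esub> snd p)"])
      (auto simp: semidirect_simps R.l_neg M.l_neg)
next
  fix p q r assume "p \<in> carrier S" "q \<in> carrier S" "r \<in> carrier S"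
  then show "(p \<otimes>\<^bsub>S\<^esub> q) \<otimes>\<^bsub>S\<^esub> r = p \<otimes>\<^bsub>S\<^esub> (q \<otimes>\<^bsub>S\<^esub> r)"
    by (auto simp: semidirect_simps smult_r_distr smult_assoc1[symmetric] R.m_ac M.a_ac)
next
  fix p q r assume "p \<in> carrier S" "q \<in> carrier S" "r \<in> carrier S"
  then show "(p \<oplus>\<^bsub>S\<^esub> q) \<otimes>\<^bsub>S\<^esub> r = p \<otimes>\<^bsub>S\<^esub> r \<oplus>\<^bsub>S\<^esub> q \<otimes>\<^bsub>S\<^esub> r"
    by (auto simp: semidirect_simps smult_r_distr smult_l_distr R.l_distr M.a_ac)
qed (auto simp: semidirect_simps R.a_ac M.a_ac R.m_ac)

interpretation S: cring S by (rule semidirect_cring)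

lemma fst_semidirect_nat_pow: "fst (p [^]\<^bsub>S\<^esub> (n::nat)) = fst p [^] n"
  by (induction n) (simp_all add: semidirect_simps)

lemma semidirect_finsum_fst_zero:
  assumes "finite K" "\<And>i. i \<in> K \<Longrightarrow> f i \<in> carrier S" "\<And>i. i \<in> K \<Longrightarrow> fst (f i) = \<zero>"
  shows "fst (\<Oplus>\<^bsub>S\<^esub>i\<in>K. f i) = \<zero>"
  using assms by (induction K rule: finite_induct) (simp_all add: semidirect_simps(4,5) Pi_iff)

context
  fixes \<alpha> :: "nat + nat \<Rightarrow> 'a \<times> 'c"
  assumes \<alpha>_closed: "\<And>v. \<alpha> v \<in> carrier S" and \<alpha>_Inr: "\<And>e. fst (\<alpha> (Inr e)) = \<zero>"
begin

text \<open>Serves to split off second variables one at a time: the first puts the value into the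
  ideal \<open>M\<close>, a second one makes it zero.\<close>

lemma monom_eval_weight_ge_1:
  assumes "1 \<le> monom_weight snd_weight m"
  obtains e m' where "monom_eval S \<alpha> m = \<alpha> (Inr e) \<otimes>\<^bsub>S\<^esub> monom_eval S \<alpha> m'"
    "monom_weight snd_weight m = Suc (monom_weight snd_weight m')"
proof -
  have "\<exists>v\<in>Poly_Mapping.keys m. snd_weight v > 0"
  proof (rule ccontr)
    assume "\<not> ?thesis"
    then have "monom_weight snd_weight m = 0" by (simp add: monom_weight_def)
    with assms show False by simp
  qed
  then obtain v where v: "v \<in> Poly_Mapping.keys m" "snd_weight v > 0" by blast
  then obtain e where e: "v = Inr e" by (cases v) auto
  define m' where "m' = m - Poly_Mapping.single v 1"
  have m: "m = Poly_Mapping.single v 1 + m'"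
    using v(1) by (intro poly_mapping_eqI)
      (auto simp: m'_def lookup_add lookup_minus lookup_single when_def in_keys_iff)
  have "\<alpha> v [^]\<^bsub>S\<^esub> (1::nat) = \<alpha> v" by (simp add: \<alpha>_closed)
  then have "monom_eval S \<alpha> m = \<alpha> (Inr e) \<otimes>\<^bsub>S\<^esub> monom_eval S \<alpha> m'"
    unfolding m e by (simp add: S.monom_eval_add S.monom_eval_single \<alpha>_closed)
  moreover have "monom_weight snd_weight m = Suc (monom_weight snd_weight m')"
    unfolding m monom_weight_add e by (simp add: monom_weight_def)
  ultimately show ?thesis by (rule that)
qed

lemma fst_monom_eval_weight:
  assumes "1 \<le> monom_weight snd_weight m"
  shows "fst (monom_eval S \<alpha> m) = \<zero>"
proof -
  have "fst (monom_eval S \<alpha> m') \<in> carrier R" for m'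
    using S.monom_eval_closed[of \<alpha> m', OF \<alpha>_closed] by (auto simp: semidirect_simps)
  moreover obtain e m' where "monom_eval S \<alpha> m = \<alpha> (Inr e) \<otimes>\<^bsub>S\<^esub> monom_eval S \<alpha> m'"
    by (rule monom_eval_weight_ge_1[OF assms])
  ultimately show ?thesis by (simp add: semidirect_simps(2) \<alpha>_Inr)
qed

lemma monom_eval_weight_ge_2:
  assumes "2 \<le> monom_weight snd_weight m"
  shows "monom_eval S \<alpha> m = \<zero>\<^bsub>S\<^esub>"
proof -
  obtain e m' where m: "monom_eval S \<alpha> m = \<alpha> (Inr e) \<otimes>\<^bsub>S\<^esub> monom_eval S \<alpha> m'"
    "monom_weight snd_weight m = Suc (monom_weight snd_weight m')"
    by (rule monom_eval_weight_ge_1[of m]) (use assms in auto)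
  have "snd (monom_eval S \<alpha> m') \<in> carrier M" "snd (\<alpha> (Inr e)) \<in> carrier M"
    using S.monom_eval_closed[of \<alpha> m', OF \<alpha>_closed] \<alpha>_closed[of "Inr e"]
    by (auto simp: semidirect_simps)
  moreover have "fst (monom_eval S \<alpha> m') = \<zero>"
    using m(2) assms by (intro fst_monom_eval_weight) simp
  ultimately show ?thesis by (simp add: m(1) semidirect_simps(2,4) \<alpha>_Inr)
qed

lemma ipoly_eval_filtration_1:
  assumes p: "p \<in> ipoly_filtration snd_weight 1"
  shows "fst (ipoly_eval S \<alpha> p) = \<zero>"
  unfolding ipoly_eval_def monom_eval_def[symmetric]
proof (rule semidirect_finsum_fst_zero)
  fix m assume m: "m \<in> Poly_Mapping.keys p"
  let ?c = "Poly_Mapping.lookup p m"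
  have cl: "monom_eval S \<alpha> m \<in> carrier S" by (rule S.monom_eval_closed[OF \<alpha>_closed])
  then show "[?c] \<cdot>\<^bsub>S\<^esub> monom_eval S \<alpha> m \<in> carrier S" by simp
  \<comment> \<open>Writing the integer multiple as a product makes its ring component visible
    through the multiplication of \<open>S\<close>.\<close>
  have "[?c] \<cdot>\<^bsub>S\<^esub> monom_eval S \<alpha> m = ([?c] \<cdot>\<^bsub>S\<^esub> \<one>\<^bsub>S\<^esub>) \<otimes>\<^bsub>S\<^esub> monom_eval S \<alpha> m"
    using cl by (simp add: S.add_pow_ldistr_int)
  moreover have "fst (monom_eval S \<alpha> m) = \<zero>"
    using p m by (intro fst_monom_eval_weight) (simp add: ipoly_filtration_def)
  moreover have "fst ([?c] \<cdot>\<^bsub>S\<^esub> \<one>\<^bsub>S\<^esub>) \<in> carrier R"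
    using S.add.int_pow_closed[OF S.one_closed, of ?c] by (auto simp: semidirect_simps)
  ultimately show "fst ([?c] \<cdot>\<^bsub>S\<^esub> monom_eval S \<alpha> m) = \<zero>"
    by (simp add: semidirect_simps(2))
qed simp

lemma ipoly_eval_filtration_2:
  assumes "p \<in> ipoly_filtration snd_weight 2"
  shows "ipoly_eval S \<alpha> p = \<zero>\<^bsub>S\<^esub>"
  unfolding ipoly_eval_def monom_eval_def[symmetric]
  using assms
  by (intro S.add.finprod_one_eqI)
    (simp add: ipoly_filtration_def monom_eval_weight_ge_2 S.add.int_pow_one)

lemma snd_ipoly_eval_sum:
  "finite K \<Longrightarrow> snd (ipoly_eval S \<alpha> (\<Sum>i\<in>K. p i)) = (\<Oplus>\<^bsub>M\<^esub>i\<in>K. snd (ipoly_eval S \<alpha> (p i)))"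
proof (induction K rule: finite_induct)
  case (insert i K)
  have "snd (ipoly_eval S \<alpha> (p i)) \<in> carrier M" for i
    using S.ipoly_eval_closed[of \<alpha> "p i", OF \<alpha>_closed] by (auto simp: semidirect_simps)
  with insert show ?case
    by (simp add: S.ipoly_eval_add[OF \<alpha>_closed] semidirect_simps(5) Pi_iff)
qed (simp add: S.ipoly_eval_zero[OF \<alpha>_closed] semidirect_simps(4))

text \<open>The congruences of orders one and two for \<open>witt_add_poly\<close> become equations
  here, as weight 1 vanishes in the ring component and weight 2 vanishes altogether. The factor
  \<open>n\<close> was already cancelled universally, so \<open>M\<close> may have torsion.\<close>

lemma witt_add_poly_eval:
  assumes n: "n > 0" and Inl: "\<And>e. snd (\<alpha> (Inl e)) = \<zero>\<^bsub>M\<^esub>"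
  shows "fst (ipoly_eval S \<alpha> (witt_add_poly n)) = fst (\<alpha> (Inl n))"
    and "snd (\<alpha> (Inr n)) = (\<Oplus>\<^bsub>M\<^esub>e\<in>{e. e dvd n}.
      (fst (\<alpha> (Inl e)) [^] (n div e - 1)) \<odot>\<^bsub>M\<^esub> snd (ipoly_eval S \<alpha> (witt_add_poly e)))"
proof -
  let ?ev = "ipoly_eval S \<alpha>"
  let ?T = "\<lambda>e. witt_add_poly e - ipoly_var (Inl e)"
  note hom = S.ipoly_eval_add[OF \<alpha>_closed] S.ipoly_eval_mult[OF \<alpha>_closed]
    S.ipoly_eval_power[OF \<alpha>_closed] S.ipoly_eval_var[OF \<alpha>_closed]
  have cl: "fst (?ev p) \<in> carrier R" "snd (?ev p) \<in> carrier M" for p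
    using S.ipoly_eval_closed[of \<alpha> p, OF \<alpha>_closed] by (auto simp: semidirect_simps)
  have \<alpha>: "fst (\<alpha> v) \<in> carrier R" "snd (\<alpha> v) \<in> carrier M" for v
    using \<alpha>_closed[of v] by (auto simp: semidirect_simps)
  have T: "fst (?ev (witt_add_poly e)) = fst (\<alpha> (Inl e))" "fst (?ev (?T e)) = \<zero>"
    "snd (?ev (?T e)) = snd (?ev (witt_add_poly e))" if "e > 0" for e
  proof -
    show T1: "fst (?ev (?T e)) = \<zero>"
      by (intro ipoly_eval_filtration_1 witt_add_poly_first_order that)
    have "?ev (?T e) \<oplus>\<^bsub>S\<^esub> \<alpha> (Inl e) = ?ev (?T e + ipoly_var (Inl e))"
      by (simp only: hom)
    then have "?ev (witt_add_poly e) = ?ev (?T e) \<oplus>\<^bsub>S\<^esub> \<alpha> (Inl e)" by simp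
    then show "fst (?ev (witt_add_poly e)) = fst (\<alpha> (Inl e))"
      "snd (?ev (?T e)) = snd (?ev (witt_add_poly e))"
      using T1 Inl cl \<alpha> by (simp_all add: semidirect_simps(5))
  qed
  show "fst (?ev (witt_add_poly n)) = fst (\<alpha> (Inl n))" by (rule T(1)[OF n])
  let ?L = "\<Sum>e\<in>{e. e dvd n}. ipoly_var (Inl e) ^ (n div e - 1) * ?T e"
  \<comment> \<open>Additivity is applied to \<open>(?L - y_n) + y_n\<close>, whose first summand
    has weight 2 and therefore value zero.\<close>
  have "\<alpha> (Inr n) = \<zero>\<^bsub>S\<^esub> \<oplus>\<^bsub>S\<^esub> \<alpha> (Inr n)" using \<alpha>_closed by simp
  also have "\<dots> = ?ev (?L - ipoly_var (Inr n)) \<oplus>\<^bsub>S\<^esub> ?ev (ipoly_var (Inr n))"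
    by (simp only: ipoly_eval_filtration_2[OF witt_add_poly_second_order[OF n]] hom)
  also have "\<dots> = ?ev ?L" by (simp add: S.ipoly_eval_add[OF \<alpha>_closed, symmetric])
  finally have "snd (\<alpha> (Inr n)) = (\<Oplus>\<^bsub>M\<^esub>e\<in>{e. e dvd n}.
      snd (?ev (ipoly_var (Inl e) ^ (n div e - 1) * ?T e)))"
    using n by (simp add: snd_ipoly_eval_sum)
  also have "\<dots> = (\<Oplus>\<^bsub>M\<^esub>e\<in>{e. e dvd n}.
      (fst (\<alpha> (Inl e)) [^] (n div e - 1)) \<odot>\<^bsub>M\<^esub> snd (?ev (witt_add_poly e)))"
  proof (rule M.finsum_cong')
    fix e assume "e \<in> {e. e dvd n}"
    then have "e > 0" using n by (auto dest: dvd_pos_nat)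
    \<comment> \<open>Needed to discard the summand in which this component is multiplied by the
      vanishing ring component of \<open>?T e\<close>.\<close>
    moreover have "snd (\<alpha> (Inl e) [^]\<^bsub>S\<^esub> (n div e - 1)) \<in> carrier M"
      using S.nat_pow_closed[OF \<alpha>_closed] by (simp add: semidirect_simps(1) mem_Times_iff)
    ultimately show "snd (?ev (ipoly_var (Inl e) ^ (n div e - 1) * ?T e)) =
      (fst (\<alpha> (Inl e)) [^] (n div e - 1)) \<odot>\<^bsub>M\<^esub> snd (?ev (witt_add_poly e))"
      by (simp add: hom T semidirect_simps(2) fst_semidirect_nat_pow cl \<alpha>)
  qed (auto simp: cl \<alpha>)
  finally show "snd (\<alpha> (Inr n)) = (\<Oplus>\<^bsub>M\<^esub>e\<in>{e. e dvd n}.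
      (fst (\<alpha> (Inl e)) [^] (n div e - 1)) \<odot>\<^bsub>M\<^esub> snd (?ev (witt_add_poly e)))" .
qed

end

end

end

section \<open>The correspondence\<close>

text \<open>The system is unitriangular: for \<open>e = n\<close> the coefficient is
  \<open>u n\<close> to the power 0, and the terms at proper divisors agree by induction and
  cancel.\<close>

lemma (in Module.module) divisor_sum_inject:
  fixes u :: "nat \<Rightarrow> 'a" and t t' :: "nat \<Rightarrow> 'c"
  assumes u: "\<And>n. n > 0 \<Longrightarrow> u n \<in> carrier R"
    and t: "\<And>n. n > 0 \<Longrightarrow> t n \<in> carrier M" and t': "\<And>n. n > 0 \<Longrightarrow> t' n \<in> carrier M"
    and eq: "\<And>n. n > 0 \<Longrightarrow>
      (\<Oplus>\<^bsub>M\<^esub>e\<in>{e. e dvd n}. (u e [^] (n div e - 1)) \<odot>\<^bsub>M\<^esub> t e) =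
      (\<Oplus>\<^bsub>M\<^esub>e\<in>{e. e dvd n}. (u e [^] (n div e - 1)) \<odot>\<^bsub>M\<^esub> t' e)"
  shows "n > 0 \<Longrightarrow> t n = t' n"
proof (induction n rule: less_induct)
  case (less n)
  have pos: "e > 0" if "e dvd n" for e
    using that less.prems by (rule dvd_pos_nat[rotated])
  have split: "(\<Oplus>\<^bsub>M\<^esub>e\<in>{e. e dvd n}. (u e [^] (n div e - 1)) \<odot>\<^bsub>M\<^esub> s e) =
      s n \<oplus>\<^bsub>M\<^esub> (\<Oplus>\<^bsub>M\<^esub>e\<in>{e. e dvd n \<and> e < n}. (u e [^] (n div e - 1)) \<odot>\<^bsub>M\<^esub> s e)"
    if "\<And>n. n > 0 \<Longrightarrow> s n \<in> carrier M" for s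
    unfolding divisors_split[OF less.prems] using that less.prems u pos by (simp add: Pi_iff)
  have "(\<Oplus>\<^bsub>M\<^esub>e\<in>{e. e dvd n \<and> e < n}. (u e [^] (n div e - 1)) \<odot>\<^bsub>M\<^esub> t e) =
      (\<Oplus>\<^bsub>M\<^esub>e\<in>{e. e dvd n \<and> e < n}. (u e [^] (n div e - 1)) \<odot>\<^bsub>M\<^esub> t' e)"
    using less.IH pos u t' by (intro M.finsum_cong') (auto simp: Pi_iff)
  then have "t n \<oplus>\<^bsub>M\<^esub> (\<Oplus>\<^bsub>M\<^esub>e\<in>{e. e dvd n \<and> e < n}. (u e [^] (n div e - 1)) \<odot>\<^bsub>M\<^esub> t' e) =
      t' n \<oplus>\<^bsub>M\<^esub> (\<Oplus>\<^bsub>M\<^esub>e\<in>{e. e dvd n \<and> e < n}. (u e [^] (n div e - 1)) \<odot>\<^bsub>M\<^esub> t' e)"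
    using eq[OF less.prems] by (simp only: split t t')
  moreover have "(\<Oplus>\<^bsub>M\<^esub>e\<in>{e. e dvd n \<and> e < n}. (u e [^] (n div e - 1)) \<odot>\<^bsub>M\<^esub> t' e) \<in> carrier M"
    using pos u t' by (intro M.finsum_closed) auto
  ultimately show ?case
    using t t' less.prems by (simp only: M.add.right_cancel)
qed

section \<open>Components of the \<lambda>-structure on the extension, and morphisms as
  graphs\<close>

context lambda_module
begin

lemma lamA_closed: "a \<in> carrier A \<Longrightarrow> n > 0 \<Longrightarrow> lamA a n \<in> carrier A"
  using ring_hom_closed[OF lam_hom, of a] by (auto simp: witt_ring_def witt_carrier_def)

lemma semidirect_lam_extensional: "semidirect_lam A lamA M lamM p \<in> extensional {0<..}"
  by (simp add: semidirect_lam_def witt_ring_def case_prod_unfold)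

lemma semidirect_lam_components:
  assumes a: "a \<in> carrier A" and x: "x \<in> carrier M" and n: "n > 0"
  shows "fst (semidirect_lam A lamA M lamM (a, x) n) = lamA a n"
    and "snd (semidirect_lam A lamA M lamM (a, x) n) \<in> carrier M"
    and "lamM n x = (\<Oplus>\<^bsub>M\<^esub>e\<in>{e. e dvd n}.
      (lamA a e [^] (n div e - 1)) \<odot>\<^bsub>M\<^esub> snd (semidirect_lam A lamA M lamM (a, x) e))"
proof -
  let ?S = "semidirect A M"
  interpret S: cring ?S by (rule semidirect_cring)
  \<comment> \<open>Agrees with the two Witt vectors being added at positive indices, and takes the
    value zero at index 0 in order to stay in the carrier everywhere. The addition polynomials do
    not involve the variables of index 0.\<close>
  define \<alpha> where "\<alpha> = case_sum
    (\<lambda>e. (if e > 0 then lamA a e else \<zero>, \<zero>\<^bsub>M\<^esub>))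
    (\<lambda>e. (\<zero>, if e > 0 then lamM e x else \<zero>\<^bsub>M\<^esub>))"
  have \<alpha>: "\<alpha> (Inl e) = (if e > 0 then lamA a e else \<zero>, \<zero>\<^bsub>M\<^esub>)"
    "\<alpha> (Inr e) = (\<zero>, if e > 0 then lamM e x else \<zero>\<^bsub>M\<^esub>)" for e
    by (simp_all add: \<alpha>_def)
  have \<alpha>_closed: "\<alpha> v \<in> carrier ?S" for v
    using a x by (cases v) (auto simp: \<alpha> semidirect_simps(1) lamA_closed lamM_closed)
  have lam: "semidirect_lam A lamA M lamM (a, x) e = ipoly_eval ?S \<alpha> (witt_add_poly e)"
    if e: "e > 0" for e
  proof -
    let ?\<beta> = "case_sum (witt_map (\<lambda>b. (b, \<zero>\<^bsub>M\<^esub>)) (lamA a))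
      (witt_map (\<lambda>y. (\<zero>, y)) (\<lambda>n\<in>{0<..}. lamM n x))"
    have "semidirect_lam A lamA M lamM (a, x) e = ipoly_eval ?S ?\<beta> (witt_add_poly e)"
      using e by (simp add: semidirect_lam_def witt_ring_def)
    also have "\<dots> = ipoly_eval ?S \<alpha> (witt_add_poly e)"
    proof (rule S.ipoly_eval_cong)
      fix v assume "v \<in> ipoly_vars (witt_add_poly e)"
      then have "v \<in> {0<..} <+> {0<..}" using ipoly_vars_witt_add_poly[OF e] by blast
      then show "?\<beta> v = \<alpha> v" by (auto simp: \<alpha> witt_map_def)
    qed (rule \<alpha>_closed)
    finally show ?thesis .
  qed
  note eval = witt_add_poly_eval[of \<alpha>, OF \<alpha>_closed _ n]
  show "fst (semidirect_lam A lamA M lamM (a, x) n) = lamA a n"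
    using eval(1) n by (simp add: lam \<alpha>)
  show "snd (semidirect_lam A lamA M lamM (a, x) n) \<in> carrier M"
    using S.ipoly_eval_closed[of \<alpha> "witt_add_poly n", OF \<alpha>_closed] n
    by (simp add: lam semidirect_simps(1) mem_Times_iff)
  have "lamM n x = (\<Oplus>\<^bsub>M\<^esub>e\<in>{e. e dvd n}.
      (fst (\<alpha> (Inl e)) [^] (n div e - 1)) \<odot>\<^bsub>M\<^esub> snd (ipoly_eval ?S \<alpha> (witt_add_poly e)))"
    using eval(2) n by (simp add: \<alpha>)
  also have "\<dots> = (\<Oplus>\<^bsub>M\<^esub>e\<in>{e. e dvd n}.
      (lamA a e [^] (n div e - 1)) \<odot>\<^bsub>M\<^esub> snd (semidirect_lam A lamA M lamM (a, x) e))"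
  proof (rule M.finsum_cong')
    have pos: "e > 0" if "e \<in> {e. e dvd n}" for e
      using that n by (auto dest: dvd_pos_nat)
    show "(\<lambda>e. (lamA a e [^] (n div e - 1)) \<odot>\<^bsub>M\<^esub> snd (semidirect_lam A lamA M lamM (a, x) e))
        \<in> {e. e dvd n} \<rightarrow> carrier M"
      using S.ipoly_eval_closed[of \<alpha>, OF \<alpha>_closed] pos a
      by (auto simp: lam lamA_closed semidirect_simps(1) mem_Times_iff)
    show "(fst (\<alpha> (Inl e)) [^] (n div e - 1)) \<odot>\<^bsub>M\<^esub> snd (ipoly_eval ?S \<alpha> (witt_add_poly e)) =
        (lamA a e [^] (n div e - 1)) \<odot>\<^bsub>M\<^esub> snd (semidirect_lam A lamA M lamM (a, x) e)"
      if "e \<in> {e. e dvd n}" for e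
      using pos[OF that] by (simp add: \<alpha> lam)
  qed simp
  finally show "lamM n x = (\<Oplus>\<^bsub>M\<^esub>e\<in>{e. e dvd n}.
      (lamA a e [^] (n div e - 1)) \<odot>\<^bsub>M\<^esub> snd (semidirect_lam A lamA M lamM (a, x) e))" .
qed

text \<open>The module components of the \<lambda>-structure at \<open>(a, D a)\<close> solve the
  divisor-sum system with right-hand side \<open>lamM n (D a)\<close>. The derivation equation says
  that the elements \<open>D (lamA a n)\<close> solve it too, and the solution is unique.\<close>

lemma semidirect_lam_eq_iff:
  assumes a: "a \<in> carrier A" and D: "D \<in> carrier A \<rightarrow> carrier M"
  shows "semidirect_lam A lamA M lamM (a, D a) = witt_map (\<lambda>a\<in>carrier A. (a, D a)) (lamA a) \<longleftrightarrow>
    (\<forall>n>0. lamM n (D a) = (\<Oplus>\<^bsub>M\<^esub>e\<in>{e. e dvd n}. (lamA a e [^] (n div e - 1)) \<odot>\<^bsub>M\<^esub> D (lamA a e)))"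
    (is "?l = ?r \<longleftrightarrow> (\<forall>n>0. ?P n)")
proof
  have Da: "D a \<in> carrier M" using a D by auto
  note comp = semidirect_lam_components[OF a Da]
  have r: "?r n = (lamA a n, D (lamA a n))" if "n > 0" for n
    using that a by (simp add: witt_map_def lamA_closed)
  {
    assume lr: "?l = ?r"
    show "\<forall>n>0. ?P n"
    proof (intro allI impI)
      fix n :: nat assume n: "n > 0"
      show "?P n"
        unfolding comp(3)[OF n]
      proof (rule M.finsum_cong')
        fix e assume "e \<in> {e. e dvd n}"
        then have "e > 0" using n by (auto dest: dvd_pos_nat)
        then show "(lamA a e [^] (n div e - 1)) \<odot>\<^bsub>M\<^esub> snd (?l e) =
            (lamA a e [^] (n div e - 1)) \<odot>\<^bsub>M\<^esub> D (lamA a e)"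
          by (simp add: lr r)
      next
        show "(\<lambda>e. (lamA a e [^] (n div e - 1)) \<odot>\<^bsub>M\<^esub> D (lamA a e)) \<in> {e. e dvd n} \<rightarrow> carrier M"
          using n a D by (auto intro!: smult_closed nat_pow_closed lamA_closed
              funcset_mem[OF D] dest: dvd_pos_nat)
      qed simp
    qed
  next
    assume P: "\<forall>n>0. ?P n"
    have "snd (?l n) = D (lamA a n)" if "n > 0" for n
    proof (rule divisor_sum_inject[of "lamA a" "\<lambda>n. snd (?l n)" "\<lambda>n. D (lamA a n)", OF _ _ _ _ that])
      show "(\<Oplus>\<^bsub>M\<^esub>e\<in>{e. e dvd n}. (lamA a e [^] (n div e - 1)) \<odot>\<^bsub>M\<^esub> snd (?l e)) =
          (\<Oplus>\<^bsub>M\<^esub>e\<in>{e. e dvd n}. (lamA a e [^] (n div e - 1)) \<odot>\<^bsub>M\<^esub> D (lamA a e))" if "n > 0" for n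
        by (rule trans[OF comp(3)[OF that, symmetric] P[rule_format, OF that]])
    qed (use a D in \<open>auto simp: comp lamA_closed intro!: funcset_mem[OF D]\<close>)
    then show "?l = ?r"
      using semidirect_lam_extensional
      by (intro extensionalityI[where A = "{0<..}"])
        (auto simp: r comp witt_map_def lamA_closed[OF a] intro: prod_eqI)
  }
qed

text \<open>Comes from the Leibniz rule at \<open>\<one> \<otimes> \<one>\<close>; it is what makes
  the graph of \<open>D\<close> preserve the unit.\<close>

lemma lambda_der_one:
  assumes "D \<in> lambda_der A lamA M lamM"
  shows "D \<one> = \<zero>\<^bsub>M\<^esub>"
proof -
  have D: "D \<one> \<in> carrier M" using assms by (auto simp: lambda_der_def)
  have "D (\<one> \<otimes> \<one>) = \<one> \<odot>\<^bsub>M\<^esub> D \<one> \<oplus>\<^bsub>M\<^esub> \<one> \<odot>\<^bsub>M\<^esub> D \<one>"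
    using assms one_closed unfolding lambda_der_def by blast
  then have "D \<one> = D \<one> \<oplus>\<^bsub>M\<^esub> D \<one>" using D by simp
  then show ?thesis using D by (metis M.add.l_cancel_one')
qed

text \<open>The conditions correspond one by one: sums to additivity, products to the Leibniz rule,
  the \<lambda>-structures to the divisor-sum equation. Lying over \<open>A\<close> is built into
  the first component.\<close>

lemma graph_in_lambda_over_hom_iff:
  assumes D: "D \<in> carrier A \<rightarrow>\<^sub>E carrier M"
  shows "(\<lambda>a\<in>carrier A. (a, D a)) \<in> lambda_over_hom A lamA (\<lambda>a. a)
      (semidirect A M) (semidirect_lam A lamA M lamM) fst \<longleftrightarrow> D \<in> lambda_der A lamA M lamM"
    (is "?h \<in> ?H \<longleftrightarrow> _")
proof -
  have Dc: "D a \<in> carrier M" if "a \<in> carrier A" for a using D that by auto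
  have lam: "semidirect_lam A lamA M lamM (?h a) = witt_map ?h (lamA a) \<longleftrightarrow>
    (\<forall>n>0. lamM n (D a) = (\<Oplus>\<^bsub>M\<^esub>e\<in>{e. e dvd n}. (lamA a e [^] (n div e - 1)) \<odot>\<^bsub>M\<^esub> D (lamA a e)))"
    if "a \<in> carrier A" for a
    using semidirect_lam_eq_iff[OF that, of D] D that by auto
  have hom: "?h \<in> ring_hom A (semidirect A M) \<longleftrightarrow>
      (\<forall>a\<in>carrier A. \<forall>b\<in>carrier A. D (a \<oplus> b) = D a \<oplus>\<^bsub>M\<^esub> D b) \<and>
      (\<forall>a\<in>carrier A. \<forall>b\<in>carrier A. D (a \<otimes> b) = b \<odot>\<^bsub>M\<^esub> D a \<oplus>\<^bsub>M\<^esub> a \<odot>\<^bsub>M\<^esub> D b) \<and>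
      D \<one> = \<zero>\<^bsub>M\<^esub>"
    \<comment> \<open>Commutativity is used because the product in the extension lists the two
      Leibniz summands in the opposite order.\<close>
    by (auto simp: ring_hom_def semidirect_simps Dc M.a_comm)
  show ?thesis
  proof
    assume "?h \<in> ?H"
    then show "D \<in> lambda_der A lamA M lamM"
      \<comment> \<open>The restriction stays folded so that \<open>hom\<close> and
        \<open>lam\<close> apply to \<open>?h\<close>.\<close>
      using D by (auto simp: lambda_over_hom_def lambda_hom_def lambda_der_def hom lam
          simp del: restrict_apply restrict_apply')
  next
    assume d: "D \<in> lambda_der A lamA M lamM"
    then have "?h \<in> ring_hom A (semidirect A M)"
      unfolding hom using lambda_der_one[OF d] by (simp add: lambda_der_def)
    moreover have "semidirect_lam A lamA M lamM (?h a) = witt_map ?h (lamA a)" if "a \<in> carrier A" for a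
      using lam[OF that] d that by (simp add: lambda_der_def)
    ultimately show "?h \<in> ?H"
      by (simp add: lambda_over_hom_def lambda_hom_def)
  qed
qed

text \<open>A morphism from the identity to the projection has identity first component, so its
  second component, cut down to the carrier, serves as \<open>D\<close>.\<close>

lemma graph_of_lambda_over_hom:
  assumes h: "h \<in> lambda_over_hom A lamA (\<lambda>a. a) (semidirect A M) (semidirect_lam A lamA M lamM) fst"
  obtains D where "D \<in> carrier A \<rightarrow>\<^sub>E carrier M" "h = (\<lambda>a\<in>carrier A. (a, D a))"
proof
  have "h a \<in> carrier A \<times> carrier M" "fst (h a) = a" if "a \<in> carrier A" for a
    using h that ring_hom_closed[of h A "semidirect A M" a]
    by (auto simp: lambda_over_hom_def lambda_hom_def semidirect_simps(1))
  moreover have "h \<in> extensional (carrier A)"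
    using h by (simp add: lambda_over_hom_def lambda_hom_def)
  ultimately show "(\<lambda>a\<in>carrier A. snd (h a)) \<in> carrier A \<rightarrow>\<^sub>E carrier M"
    "h = (\<lambda>a\<in>carrier A. (a, (\<lambda>a\<in>carrier A. snd (h a)) a))"
    by (auto simp: mem_Times_iff prod_eq_iff intro!: extensionalityI[of h "carrier A"])
qed

end

theorem proposition2p13:
  fixes A :: "('a, 'c) ring_scheme" and lamA :: "'a \<Rightarrow> nat \<Rightarrow> 'a"
    and M :: "('a, 'b, 'd) module_scheme" and lamM :: "nat \<Rightarrow> 'b \<Rightarrow> 'b"
  assumes "lambda_ring A lamA"
    and "lambda_module A lamA M lamM"
  shows "bij_betw (\<lambda>D. \<lambda>a\<in>carrier A. (a, D a))
    (lambda_der A lamA M lamM)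
    (lambda_over_hom A lamA (\<lambda>a. a)
       (semidirect A M) (semidirect_lam A lamA M lamM) fst)"
proof -
  interpret lambda_module A lamA M lamM by (rule assms(2))
  have der: "D \<in> carrier A \<rightarrow>\<^sub>E carrier M" if "D \<in> lambda_der A lamA M lamM" for D
    using that by (simp add: lambda_der_def)
  show ?thesis
  proof (rule bij_betw_imageI)
    show "inj_on (\<lambda>D. \<lambda>a\<in>carrier A. (a, D a)) (lambda_der A lamA M lamM)"
    proof (rule inj_onI)
      fix D E assume DE: "D \<in> lambda_der A lamA M lamM" "E \<in> lambda_der A lamA M lamM"
        and eq: "(\<lambda>a\<in>carrier A. (a, D a)) = (\<lambda>a\<in>carrier A. (a, E a))"
      show "D = E"
      proof (rule PiE_ext[OF der der])
        show "D a = E a" if "a \<in> carrier A" for a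
          using fun_cong[OF eq, of a] that by simp
      qed (rule DE)+
    qed
    show "(\<lambda>D. \<lambda>a\<in>carrier A. (a, D a)) ` lambda_der A lamA M lamM = lambda_over_hom A lamA (\<lambda>a. a)
      (semidirect A M) (semidirect_lam A lamA M lamM) fst" (is "?f ` ?D = ?H")
    proof (intro subset_antisym subsetI)
      fix h assume "h \<in> ?f ` ?D"
      then show "h \<in> ?H" by (auto simp: graph_in_lambda_over_hom_iff der)
    next
      fix h assume h: "h \<in> ?H"
      then obtain D where D: "D \<in> carrier A \<rightarrow>\<^sub>E carrier M" "h = ?f D"
        by (rule graph_of_lambda_over_hom)
      with h have "D \<in> ?D" using graph_in_lambda_over_hom_iff by simp
      with D(2) show "h \<in> ?f ` ?D" by (rule image_eqI)
    qed
  qed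
qed

end
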